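(* Work in Setting (U) and assume moreover: (i) $\operatorname{ann}_S(p)=S\operatorname{ann}_R(p)$ for every $R$-nice $p\in S$; (ii) for all left ideals $L,L'$ of $R$ with $L\cap L'=0$ one has $SL\cap SL'=0$. Let $A$ be an essentially special subextension of $S[x;\alpha,\delta]$, i.e. a nicely essential subring of a special subextension $\widetilde A$ of $S[x;\alpha,\delta]$, and assume that for every $0\ne a\in R$, $\widetilde Aa$ contains an $R$-nice element of $x$-degree $d_{\widetilde A}$. Suppose that for every $m\in\operatorname{Deg}_x(\widetilde A)$, every uniform (respectively, essential) left ideal $L$ of $R$ gives a uniform (respectively, essential) left ideal $B_mL$ of the ring $B_m$ attached to $\widetilde A$. Then every uniform (respectively, essential) left ideal $L$ of $R$ gives a uniform (respectively, essential) left ideal $A\cap AL$ of $A$. In this situation, if $R$ has enough uniform left ideals, then so does $A$, and $\operatorname{udim}(A)=\operatorname{udim}(R)$.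
   Context: Setting (U): $R\subseteq S$ rings, $S$ free as left $R$-module with fixed basis $T_S$; $\alpha$ a ring automorphism of $S$, $\delta$ an $\alpha$-derivation of $S$; $S[x;\alpha,\delta]$ the Ore extension (free left $S$-module on $\{x^n\}$, $xs=\alpha(s)x+\delta(s)$), free as left $R$-module on $\{\lambda x^n:\lambda\in T_S, n\in\mathbb N\}$. For $f=\sum_kp_kx^k$, $\deg_x f$ is the largest $k$ with $p_k\ne0$. Annihilators are left annihilators. A non-zero element $f$ (of $S$ or $S[x;\alpha,\delta]$) is $R$-nice if, writing $f=\sum a_i\lambda_i$ in the relevant $R$-basis with distinct basis elements and non-zero $a_i\in R$, all $\operatorname{ann}_R(a_i)$ coincide. $\mathcal C(S)$ = regular elements of $S$. For a subring $A$ of $S[x;\alpha,\delta]$ containing $R$: $\operatorname{Deg}_x(A)=\{\deg_x f:0\ne f\in A\}$; $d_A=\gcd(\operatorname{Deg}_x(A)\setminus\{0\})$ if $A\not\subseteq S$, else $0$. Special subextension: $A=\sum_m(A\cap Sx^m)$, $\operatorname{Deg}_x(A)=d_A\mathbb N$, and for each $0\ne m\in\operatorname{Deg}_x(A)$ there exist $\lambda_m=\upsilon_mx^m\in A$ with $\upsilon_m\in\mathcal C(S)$, a subring $B_m$ with $R\subseteq B_m\subseteq A\cap S$, and an automorphism $\alpha_{(m)}$ of $B_m$ such that $\deg_x(\lambda_mp-\alpha_{(m)}(p)\lambda_m)<m$ for all $p\in B_m$ and for every $q\in S$ with $qx^m\in A$ there is $u\in B_m\cap\mathcal C(S)$ with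 $uqx^m\in B_m\lambda_m$; for $m=0$: $\lambda_0=1$, $B_0=A\cap S$, $\alpha_{(0)}=\mathrm{id}$. A subring $A$ of a ring $B$ is nicely essential if for every finite set $E\subseteq B$ of non-zero elements there is $a\in A$ with $0\ne ax\in A$ for all $x\in E$. $\operatorname{udim}$ is left uniform dimension (possibly infinite); a ring has enough uniform left ideals if every non-zero left ideal contains a uniform left ideal. *)

theory Defs
  imports Main "HOL-Library.Extended_Nat"
begin

text \<open>All rings live inside one ambient (not necessarily commutative) ring type
  'a :: ring_1, which plays the role of the Ore extension S[x;alpha,delta] itself
  (the whole type is the Ore extension, characterised by its universal normal form).
  R and S are subsets of this type; subrings are subsets containing 1 and closed
  under +, - and *.\<close>

definition is_subring :: "'a::ring_1 set \<Rightarrow> bool" where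
  "is_subring A \<longleftrightarrow> 1 \<in> A \<and> (\<forall>a\<in>A. \<forall>b\<in>A. a + b \<in> A \<and> a - b \<in> A \<and> a * b \<in> A)"

definition ring_automorphism_on :: "'a::ring_1 set \<Rightarrow> ('a \<Rightarrow> 'a) \<Rightarrow> bool" where
  "ring_automorphism_on A f \<longleftrightarrow> bij_betw f A A \<and> f 1 = 1 \<and>
     (\<forall>a\<in>A. \<forall>b\<in>A. f (a + b) = f a + f b \<and> f (a * b) = f a * f b)"

text \<open>alpha-derivation: delta(ab) = alpha(a) delta(b) + delta(a) b, matching x s = alpha(s) x + delta(s).\<close>
definition alpha_derivation :: "'a::ring_1 set \<Rightarrow> ('a \<Rightarrow> 'a) \<Rightarrow> ('a \<Rightarrow> 'a) \<Rightarrow> bool" where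
  "alpha_derivation S \<alpha> \<delta> \<longleftrightarrow> (\<forall>a\<in>S. \<delta> a \<in> S) \<and>
     (\<forall>a\<in>S. \<forall>b\<in>S. \<delta> (a + b) = \<delta> a + \<delta> b \<and> \<delta> (a * b) = \<alpha> a * \<delta> b + \<delta> a * b)"

definition ore_extension :: "'a::ring_1 set \<Rightarrow> ('a \<Rightarrow> 'a) \<Rightarrow> ('a \<Rightarrow> 'a) \<Rightarrow> 'a \<Rightarrow> bool" where
  "ore_extension S \<alpha> \<delta> x \<longleftrightarrow> is_subring S \<and> ring_automorphism_on S \<alpha> \<and> alpha_derivation S \<alpha> \<delta> \<and>
     (\<forall>s\<in>S. x * s = \<alpha> s * x + \<delta> s) \<and>
     (\<forall>f. \<exists>!c. finite {k. c k \<noteq> 0} \<and> (\<forall>k. c k \<in> S) \<and> f = (\<Sum>k | c k \<noteq> 0. c k * x ^ k))"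

definition ocoeff :: "'a::ring_1 set \<Rightarrow> 'a \<Rightarrow> 'a \<Rightarrow> nat \<Rightarrow> 'a" where
  "ocoeff S x f = (THE c. finite {k. c k \<noteq> 0} \<and> (\<forall>k. c k \<in> S) \<and> f = (\<Sum>k | c k \<noteq> 0. c k * x ^ k))"

text \<open>x-degree; the degree of 0 is set to 0 (only used in the strict inequality
  deg(lambda_m p - alpha_m(p) lambda_m) < m with m > 0, where 0 must be allowed).\<close>
definition odeg :: "'a::ring_1 set \<Rightarrow> 'a \<Rightarrow> 'a \<Rightarrow> nat" where
  "odeg S x f = (if f = 0 then 0 else Max {k. ocoeff S x f k \<noteq> 0})"

definition free_left_basis :: "'a::ring_1 set \<Rightarrow> 'a set \<Rightarrow> 'a set \<Rightarrow> bool" where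
  "free_left_basis R S T \<longleftrightarrow> T \<subseteq> S \<and>
     (\<forall>s\<in>S. \<exists>!c. finite {l. c l \<noteq> 0} \<and> {l. c l \<noteq> 0} \<subseteq> T \<and> (\<forall>l. c l \<in> R) \<and>
                  s = (\<Sum>l | c l \<noteq> 0. c l * l))"

definition rcoeff :: "'a::ring_1 set \<Rightarrow> 'a set \<Rightarrow> 'a \<Rightarrow> 'a \<Rightarrow> 'a" where
  "rcoeff R T s = (THE c. finite {l. c l \<noteq> 0} \<and> {l. c l \<noteq> 0} \<subseteq> T \<and> (\<forall>l. c l \<in> R) \<and>
                  s = (\<Sum>l | c l \<noteq> 0. c l * l))"

definition setting_U :: "'a::ring_1 set \<Rightarrow> 'a set \<Rightarrow> 'a set \<Rightarrow> ('a \<Rightarrow> 'a) \<Rightarrow> ('a \<Rightarrow> 'a) \<Rightarrow> 'a \<Rightarrow> bool" where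
  "setting_U R S T \<alpha> \<delta> x \<longleftrightarrow> is_subring R \<and> R \<subseteq> S \<and> free_left_basis R S T \<and> ore_extension S \<alpha> \<delta> x"

definition lann :: "'a::ring_1 set \<Rightarrow> 'a \<Rightarrow> 'a set" where
  "lann B a = {b \<in> B. b * a = 0}"

text \<open>R-nice: coefficients w.r.t. the R-basis {lambda x^n} of S[x;alpha,delta]
  (for f in S this is the R-basis T of S) all have the same left annihilator in R.\<close>
definition R_nice :: "'a::ring_1 set \<Rightarrow> 'a set \<Rightarrow> 'a set \<Rightarrow> 'a \<Rightarrow> 'a \<Rightarrow> bool" where
  "R_nice R S T x f \<longleftrightarrow> f \<noteq> 0 \<and>
     (\<forall>n l n' l'. rcoeff R T (ocoeff S x f n) l \<noteq> 0 \<longrightarrow> rcoeff R T (ocoeff S x f n') l' \<noteq> 0 \<longrightarrow>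
        lann R (rcoeff R T (ocoeff S x f n) l) = lann R (rcoeff R T (ocoeff S x f n') l'))"

definition sumprod :: "'a::ring_1 set \<Rightarrow> 'a set \<Rightarrow> 'a set" where
  "sumprod A X = {y. \<exists>(n::nat) a b. (\<forall>i<n. a i \<in> A \<and> b i \<in> X) \<and> y = (\<Sum>i<n. a i * b i)}"

definition left_ideal :: "'a::ring_1 set \<Rightarrow> 'a set \<Rightarrow> bool" where
  "left_ideal A L \<longleftrightarrow> L \<subseteq> A \<and> 0 \<in> L \<and> (\<forall>a\<in>L. \<forall>b\<in>L. a + b \<in> L) \<and> (\<forall>r\<in>A. \<forall>a\<in>L. r * a \<in> L)"

definition uniform_left_ideal :: "'a::ring_1 set \<Rightarrow> 'a set \<Rightarrow> bool" where
  "uniform_left_ideal A L \<longleftrightarrow> left_ideal A L \<and> L \<noteq> {0} \<and>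
     (\<forall>L1 L2. left_ideal A L1 \<longrightarrow> left_ideal A L2 \<longrightarrow> L1 \<subseteq> L \<longrightarrow> L2 \<subseteq> L \<longrightarrow>
        L1 \<noteq> {0} \<longrightarrow> L2 \<noteq> {0} \<longrightarrow> L1 \<inter> L2 \<noteq> {0})"

definition essential_left_ideal :: "'a::ring_1 set \<Rightarrow> 'a set \<Rightarrow> bool" where
  "essential_left_ideal A L \<longleftrightarrow> left_ideal A L \<and>
     (\<forall>L'. left_ideal A L' \<longrightarrow> L' \<noteq> {0} \<longrightarrow> L \<inter> L' \<noteq> {0})"

definition enough_uniform :: "'a::ring_1 set \<Rightarrow> bool" where
  "enough_uniform A \<longleftrightarrow> (\<forall>L. left_ideal A L \<longrightarrow> L \<noteq> {0} \<longrightarrow>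
      (\<exists>U. U \<subseteq> L \<and> uniform_left_ideal A U))"

definition udim :: "'a::ring_1 set \<Rightarrow> enat" where
  "udim A = Sup {enat n | n. \<exists>Ls. (\<forall>i<n. left_ideal A (Ls i) \<and> Ls i \<noteq> {0}) \<and>
      (\<forall>y. (\<forall>i<n. y i \<in> Ls i) \<longrightarrow> (\<Sum>i<n. y i) = 0 \<longrightarrow> (\<forall>i<n. y i = 0))}"

definition regular_in :: "'a::ring_1 set \<Rightarrow> 'a \<Rightarrow> bool" where
  "regular_in S u \<longleftrightarrow> u \<in> S \<and> (\<forall>s\<in>S. s * u = 0 \<longrightarrow> s = 0) \<and> (\<forall>s\<in>S. u * s = 0 \<longrightarrow> s = 0)"

definition Deg :: "'a::ring_1 set \<Rightarrow> 'a \<Rightarrow> 'a set \<Rightarrow> nat set" where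
  "Deg S x A = {odeg S x f | f. f \<in> A \<and> f \<noteq> 0}"

definition dA :: "'a::ring_1 set \<Rightarrow> 'a \<Rightarrow> 'a set \<Rightarrow> nat" where
  "dA S x A = (if A \<subseteq> S then 0 else Gcd (Deg S x A - {0}))"

text \<open>Special subextension A, with its attached data: lambda_m = ups m * x^m,
  subrings B m and automorphisms am m of B m.\<close>
definition special_subext ::
  "'a::ring_1 set \<Rightarrow> 'a set \<Rightarrow> 'a \<Rightarrow> 'a set \<Rightarrow> (nat \<Rightarrow> 'a) \<Rightarrow> (nat \<Rightarrow> 'a set) \<Rightarrow> (nat \<Rightarrow> 'a \<Rightarrow> 'a) \<Rightarrow> bool" where
  "special_subext R S x A ups B am \<longleftrightarrow>
     is_subring A \<and> R \<subseteq> A \<and>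
     A = {y. \<exists>(n::nat) g. (\<forall>m<n. g m \<in> A \<inter> {s * x ^ m | s. s \<in> S}) \<and> y = (\<Sum>m<n. g m)} \<and>
     Deg S x A = {dA S x A * k | k. True} \<and>
     (\<forall>m\<in>Deg S x A. m \<noteq> 0 \<longrightarrow>
        ups m * x ^ m \<in> A \<and> regular_in S (ups m) \<and>
        is_subring (B m) \<and> R \<subseteq> B m \<and> B m \<subseteq> A \<inter> S \<and> ring_automorphism_on (B m) (am m) \<and>
        (\<forall>p\<in>B m. odeg S x (ups m * x ^ m * p - am m p * (ups m * x ^ m)) < m) \<and>
        (\<forall>q\<in>S. q * x ^ m \<in> A \<longrightarrow>
           (\<exists>u\<in>B m. regular_in S u \<and> u * q * x ^ m \<in> {b * (ups m * x ^ m) | b. b \<in> B m}))) \<and>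
     ups 0 = 1 \<and> B 0 = A \<inter> S \<and> (\<forall>p\<in>B 0. am 0 p = p)"

definition nicely_essential :: "'a::ring_1 set \<Rightarrow> 'a set \<Rightarrow> bool" where
  "nicely_essential A B \<longleftrightarrow> is_subring A \<and> A \<subseteq> B \<and>
     (\<forall>E. finite E \<longrightarrow> E \<subseteq> B - {0} \<longrightarrow> (\<exists>a\<in>A. \<forall>y\<in>E. a * y \<noteq> 0 \<and> a * y \<in> A))"

end

theory Submission
  imports Defs
begin

text \<open>
Call \<open>f\<close> of degree \<open>m\<close> top-faithful if every \<open>s \<in> S\<close> that kills its leading coefficient kills \<open>f\<close>.
By hypothesis (i), \<open>R\<close>-nice elements are top-faithful, and every non-zero element has an \<open>R\<close>-nice multiple;
moreover such an \<open>f\<close> has the same left annihilator as a suitable \<open>c \<in> R\<close> (its shadow). Replacing \<open>f\<close> by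
\<open>g f\<close>, where \<open>g c\<close> is nice of degree \<open>d\<close>, raises the degree by \<open>d\<close> and keeps this property.

Multiplying an element of \<open>A\<^sub>t L\<close> (\<open>A\<^sub>t\<close> the special subextension) by a suitable \<open>u\<close> regular in \<open>S\<close>
puts its leading term into \<open>\<lambda>\<^sub>m B\<^sub>m L\<close>. So if \<open>f, g \<in> A\<^sub>t L\<close> have no common non-zero left multiple and
minimal total degree, uniformity of \<open>B\<^sub>m L\<close> yields top-faithful left multiples \<open>V\<close> of \<open>g\<close> and \<open>W\<close> of \<open>f\<close> with
the same leading term. The difference \<open>h = V - W\<close> has smaller degree, so it has a common multiple with \<open>f\<close>, say
\<open>q h\<close>; this forces \<open>q V = 0\<close>, hence \<open>q W = 0\<close> by top-faithfulness, hence \<open>q h = 0\<close>. The essential case is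
analogous. Hypothesis (ii) makes \<open>L \<mapsto> A\<^sub>t L\<close> preserve independent families, and an exchange argument against a
maximal independent family of uniform left ideals bounds the uniform dimension from above.
\<close>

section \<open>Subrings and left ideals\<close>

lemma is_subringD:
  assumes "is_subring A"
  shows "1 \<in> A" "a \<in> A \<Longrightarrow> b \<in> A \<Longrightarrow> a + b \<in> A" "a \<in> A \<Longrightarrow> b \<in> A \<Longrightarrow> a - b \<in> A"
    "a \<in> A \<Longrightarrow> b \<in> A \<Longrightarrow> a * b \<in> A" "0 \<in> A"
proof -
  show "1 \<in> A" "a \<in> A \<Longrightarrow> b \<in> A \<Longrightarrow> a + b \<in> A" "a \<in> A \<Longrightarrow> b \<in> A \<Longrightarrow> a - b \<in> A"
    "a \<in> A \<Longrightarrow> b \<in> A \<Longrightarrow> a * b \<in> A"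
    using assms by (auto simp: is_subring_def)
  have "1 - 1 \<in> A" using assms unfolding is_subring_def by blast
  then show "0 \<in> A" by simp
qed

lemma is_subring_sum:
  assumes "is_subring A" "\<And>i. i \<in> I \<Longrightarrow> f i \<in> A"
  shows "sum f I \<in> A"
  using assms(2) by (induction I rule: infinite_finite_induct) (auto intro: is_subringD[OF assms(1)])

lemma left_ideal_sum:
  assumes "left_ideal A L" "\<And>i. i \<in> I \<Longrightarrow> f i \<in> L"
  shows "sum f I \<in> L"
  using assms(2) by (induction I rule: infinite_finite_induct) (use assms(1) in \<open>auto simp: left_ideal_def\<close>)

lemma sumprod_mono:
  assumes "A \<subseteq> A'" "X \<subseteq> X'" shows "sumprod A X \<subseteq> sumprod A' X'"
proof
  fix y assume "y \<in> sumprod A X"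
  then obtain n :: nat and a b where "\<forall>i<n. a i \<in> A \<and> b i \<in> X" "y = (\<Sum>i<n. a i * b i)"
    unfolding sumprod_def by blast
  with assms show "y \<in> sumprod A' X'" unfolding sumprod_def by blast
qed

lemma sumprod_prodI:
  assumes "a \<in> A" "b \<in> X" shows "a * b \<in> sumprod A X"
proof -
  have "(\<forall>i<1::nat. a \<in> A \<and> b \<in> X) \<and> a * b = (\<Sum>i<1::nat. a * b)" using assms by simp
  then show ?thesis unfolding sumprod_def mem_Collect_eq
    by (intro exI[of _ "1::nat"] exI[of _ "\<lambda>_. a"] exI[of _ "\<lambda>_. b"])
qed

lemma sumprod_zero: "0 \<in> sumprod A X"
  unfolding sumprod_def by (auto intro!: exI[of _ "0::nat"])

lemma sumprod_add:
  assumes "y \<in> sumprod A X" "z \<in> sumprod A X"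
  shows "y + z \<in> sumprod A X"
proof -
  obtain n :: nat and a b where 1: "\<forall>i<n. a i \<in> A \<and> b i \<in> X" "y = (\<Sum>i<n. a i * b i)"
    using assms(1) unfolding sumprod_def by blast
  obtain m :: nat and a' b' where 2: "\<forall>i<m. a' i \<in> A \<and> b' i \<in> X" "z = (\<Sum>i<m. a' i * b' i)"
    using assms(2) unfolding sumprod_def by blast
  define a2 where "a2 = (\<lambda>i. if i < n then a i else a' (i - n))"
  define b2 where "b2 = (\<lambda>i. if i < n then b i else b' (i - n))"
  have "(\<Sum>i<n+m. a2 i * b2 i) = y + z"
    unfolding 1(2) 2(2) lessThan_atLeast0 sum.atLeastLessThan_concat[of 0 n "n+m", symmetric, simplified]
    using sum.shift_bounds_nat_ivl[of "\<lambda>i. a2 i * b2 i" 0 n m]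
    by (simp add: a2_def b2_def add.commute)
  moreover have "\<forall>i<n+m. a2 i \<in> A \<and> b2 i \<in> X"
    using 1(1) 2(1) by (auto simp: a2_def b2_def)
  ultimately show ?thesis unfolding sumprod_def mem_Collect_eq
    by (intro exI[of _ "n+m"] exI[of _ a2] exI[of _ b2]) auto
qed

lemma sumprod_sum:
  assumes "\<And>i. i \<in> I \<Longrightarrow> f i \<in> sumprod A X"
  shows "sum f I \<in> sumprod A X"
  using assms by (induction I rule: infinite_finite_induct) (auto intro: sumprod_zero sumprod_add)

lemma sumprod_mult:
  assumes "is_subring A" "a \<in> A" "y \<in> sumprod A X"
  shows "a * y \<in> sumprod A X"
proof -
  obtain n :: nat and c b where 1: "\<forall>i<n. c i \<in> A \<and> b i \<in> X" "y = (\<Sum>i<n. c i * b i)"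
    using assms(3) unfolding sumprod_def by blast
  show ?thesis unfolding 1(2) sum_distrib_left
    by (rule sumprod_sum)
      (use 1(1) is_subringD(4)[OF assms(1,2)] in \<open>auto simp: mult.assoc[symmetric] intro!: sumprod_prodI\<close>)
qed

lemma sumprod_subset:
  assumes "left_ideal B I" "X \<subseteq> I" "A \<subseteq> B"
  shows "sumprod A X \<subseteq> I"
proof
  fix y assume "y \<in> sumprod A X"
  then obtain n :: nat and a b where "\<forall>i<n. a i \<in> A \<and> b i \<in> X" "y = (\<Sum>i<n. a i * b i)"
    unfolding sumprod_def by blast
  moreover from this(1) have "a i * b i \<in> I" if "i < n" for i
    using assms that unfolding left_ideal_def by blast
  ultimately show "y \<in> I"
    by (auto intro!: left_ideal_sum[OF assms(1)])
qed

lemma left_ideal_sumprod: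
  assumes "is_subring A" "X \<subseteq> A"
  shows "left_ideal A (sumprod A X)"
proof -
  have "left_ideal A A" using is_subringD[OF assms(1)] by (auto simp: left_ideal_def)
  then have "sumprod A X \<subseteq> A" using sumprod_subset[of A A X A] assms(2) by simp
  then show ?thesis
    using assms(1) by (auto simp: left_ideal_def intro: sumprod_zero sumprod_add sumprod_mult)
qed

lemma left_ideal_principal:
  assumes "is_subring A" "f \<in> A"
  shows "left_ideal A {a * f |a. a \<in> A}"
proof -
  have "\<exists>c. a * f + b * f = c * f \<and> c \<in> A" if "a \<in> A" "b \<in> A" for a b
    using that is_subringD[OF assms(1)] by (metis distrib_right)
  moreover have "\<exists>c. r * (a * f) = c * f \<and> c \<in> A" if "a \<in> A" "r \<in> A" for a r
    using that is_subringD[OF assms(1)] by (metis mult.assoc)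
  moreover have "\<exists>a. 0 = a * f \<and> a \<in> A"
    using is_subringD(5)[OF assms(1)] by (intro exI[of _ 0]) auto
  ultimately show ?thesis
    using assms(2) is_subringD(4)[OF assms(1)] unfolding left_ideal_def by blast
qed

lemma regular_in_mult:
  assumes "is_subring S" "regular_in S u" "regular_in S v"
  shows "regular_in S (u * v)"
  using assms is_subringD(4)[OF assms(1)] unfolding regular_in_def
  by (metis mult.assoc)

lemma regular_in_one: "is_subring S \<Longrightarrow> regular_in S 1"
  by (auto simp: regular_in_def is_subring_def)

section \<open>Leading coefficients in Ore extensions\<close>

locale ore =
  fixes S :: "'a::ring_1 set" and \<alpha> \<delta> :: "'a \<Rightarrow> 'a" and x :: 'a
  assumes ore: "ore_extension S \<alpha> \<delta> x"
begin

abbreviation cf :: "'a \<Rightarrow> nat \<Rightarrow> 'a" where "cf \<equiv> ocoeff S x"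

text \<open>Bounds on the degree replace the degree itself: \<open>low n\<close> contains 0 for
  every n and \<open>low 0\<close> is {0}, so no convention for the degree of 0 is involved, and
  each \<open>low n\<close> is closed under sums and under left multiplication by S.\<close>

definition low :: "nat \<Rightarrow> 'a set" where "low n = {f. \<forall>k\<ge>n. cf f k = 0}"

lemma S_ring: "is_subring S"
  using ore by (simp add: ore_extension_def)

lemmas S_one = is_subringD(1)[OF S_ring]
lemmas S_add = is_subringD(2)[OF S_ring]
lemmas S_diff = is_subringD(3)[OF S_ring]
lemmas S_mult = is_subringD(4)[OF S_ring]
lemmas S_zero = is_subringD(5)[OF S_ring]

lemma cf_props:
  shows "finite {k. cf f k \<noteq> 0}" and cf_S: "cf f k \<in> S"
    and cf_expand: "f = (\<Sum>k | cf f k \<noteq> 0. cf f k * x ^ k)"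
proof -
  have "\<exists>!c. finite {k. c k \<noteq> 0} \<and> (\<forall>k. c k \<in> S) \<and> f = (\<Sum>k | c k \<noteq> 0. c k * x ^ k)"
    using ore by (simp add: ore_extension_def)
  from theI'[OF this, folded ocoeff_def]
  show "finite {k. cf f k \<noteq> 0}" "cf f k \<in> S" "f = (\<Sum>k | cf f k \<noteq> 0. cf f k * x ^ k)"
    by auto
qed

text \<open>The defining expansion runs over the support. Coefficients are easier to compute from an
  expansion over a fixed range in which zero terms may occur.\<close>

lemma cf_unique:
  assumes "\<And>k. c k \<in> S" "\<And>k. N \<le> k \<Longrightarrow> c k = 0" "f = (\<Sum>k<N. c k * x ^ k)"
  shows "cf f = c"
proof -
  have sub: "{k. c k \<noteq> 0} \<subseteq> {..<N}" using assms(2) by (auto simp: not_less[symmetric])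
  then have fin: "finite {k. c k \<noteq> 0}" by (rule finite_subset) simp
  have eq: "f = (\<Sum>k | c k \<noteq> 0. c k * x ^ k)"
    unfolding assms(3) by (rule sum.mono_neutral_right) (use sub in auto)
  define P where "P c \<longleftrightarrow> finite {k. c k \<noteq> 0} \<and> (\<forall>k. c k \<in> S) \<and> f = (\<Sum>k | c k \<noteq> 0. c k * x ^ k)"
    for c :: "nat \<Rightarrow> 'a"
  have "\<exists>!c. P c"
    using ore unfolding P_def ore_extension_def by blast
  moreover have "P c" unfolding P_def using fin assms(1) eq by blast
  moreover have "P (cf f)" unfolding P_def using cf_props by blast
  ultimately show ?thesis by blast
qed

lemma low_expand:
  assumes "f \<in> low N" shows "f = (\<Sum>k<N. cf f k * x ^ k)"
proof -
  have "{k. cf f k \<noteq> 0} \<subseteq> {..<N}" using assms by (auto simp: low_def not_less[symmetric])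
  then have "(\<Sum>k | cf f k \<noteq> 0. cf f k * x ^ k) = (\<Sum>k<N. cf f k * x ^ k)"
    by (intro sum.mono_neutral_left) auto
  then show ?thesis using cf_expand[of f] by simp
qed

lemma low_exists: "\<exists>N. f \<in> low N"
proof -
  obtain N where "\<forall>k\<in>{k. cf f k \<noteq> 0}. k < N"
    using cf_props(1)[of f] finite_nat_set_iff_bounded by blast
  then have "f \<in> low N" unfolding low_def by force
  then show ?thesis ..
qed

lemma low_mono: "m \<le> n \<Longrightarrow> f \<in> low m \<Longrightarrow> f \<in> low n"
  by (auto simp: low_def)

lemma cf_add: "cf (f + g) k = cf f k + cf g k"
proof -
  obtain N1 N2 where "f \<in> low N1" "g \<in> low N2" using low_exists by blast
  then have N: "f \<in> low (max N1 N2)" "g \<in> low (max N1 N2)" by (auto intro: low_mono[rotated])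
  have "cf (f + g) = (\<lambda>k. cf f k + cf g k)"
  proof (rule cf_unique)
    show "f + g = (\<Sum>k<max N1 N2. (cf f k + cf g k) * x ^ k)"
      using low_expand[OF N(1)] low_expand[OF N(2)] by (simp add: distrib_right sum.distrib)
  qed (use N in \<open>auto simp: low_def intro: S_add cf_S\<close>)
  then show ?thesis by simp
qed

lemma cf_smult: "s \<in> S \<Longrightarrow> cf (s * f) k = s * cf f k"
proof -
  assume s: "s \<in> S"
  obtain N where N: "f \<in> low N" using low_exists by blast
  have "cf (s * f) = (\<lambda>k. s * cf f k)"
  proof (rule cf_unique)
    show "s * f = (\<Sum>k<N. (s * cf f k) * x ^ k)"
      using low_expand[OF N] by (simp add: mult.assoc flip: sum_distrib_left)
  qed (use N s in \<open>auto simp: low_def intro: S_mult cf_S\<close>)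
  then show ?thesis by simp
qed

lemma cf_monom: "s \<in> S \<Longrightarrow> cf (s * x ^ m) k = (if k = m then s else 0)"
proof -
  assume s: "s \<in> S"
  have "cf (s * x ^ m) = (\<lambda>k. if k = m then s else 0)"
    by (rule cf_unique[of _ "Suc m"]) (use s S_zero in auto)
  then show ?thesis by simp
qed

lemma cf_const: "s \<in> S \<Longrightarrow> cf s k = (if k = 0 then s else 0)"
  using cf_monom[of s 0] by simp

lemma cf_zero [simp]: "cf 0 k = 0"
  using cf_const[OF S_zero] by simp

lemma cf_minus: "cf (- f) k = - cf f k"
  using cf_add[of f "- f" k] by (simp add: eq_neg_iff_add_eq_0 add.commute)

lemma cf_diff: "cf (f - g) k = cf f k - cf g k"
  using cf_add[of f "- g" k] by (simp add: cf_minus)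

lemma cf_sum: "cf (sum f I) k = (\<Sum>i\<in>I. cf (f i) k)"
  by (induction I rule: infinite_finite_induct) (auto simp: cf_add)

lemma low_0: "f \<in> low 0 \<longleftrightarrow> f = 0"
  using low_expand[of f 0] by (auto simp: low_def)

lemma low_zero: "0 \<in> low n" by (simp add: low_def)
lemma low_add: "f \<in> low n \<Longrightarrow> g \<in> low n \<Longrightarrow> f + g \<in> low n" by (simp add: low_def cf_add)
lemma low_diff: "f \<in> low n \<Longrightarrow> g \<in> low n \<Longrightarrow> f - g \<in> low n" by (simp add: low_def cf_diff)
lemma low_smult: "s \<in> S \<Longrightarrow> f \<in> low n \<Longrightarrow> s * f \<in> low n" by (simp add: low_def cf_smult)
lemma low_sum: "(\<And>i. i \<in> I \<Longrightarrow> f i \<in> low n) \<Longrightarrow> sum f I \<in> low n"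
  by (simp add: low_def cf_sum)
lemma low_Suc_iff: "f \<in> low n \<longleftrightarrow> f \<in> low (Suc n) \<and> cf f n = 0"
  by (auto simp: low_def) (metis Suc_leI le_neq_implies_less)
lemma low_const: "s \<in> S \<Longrightarrow> s \<in> low (Suc 0)" by (simp add: low_def cf_const)

lemma degree_exists:
  assumes "f \<noteq> 0" obtains m where "f \<in> low (Suc m)" "cf f m \<noteq> 0"
proof -
  obtain N where "f \<in> low N" using low_exists by blast
  then have "\<exists>m. f \<in> low (Suc m) \<and> cf f m \<noteq> 0"
  proof (induction N)
    case 0 with assms low_0 show ?case by blast
  next
    case (Suc N) then show ?case using low_Suc_iff by blast
  qed
  with that show ?thesis by blast
qed

lemma odeg_eq: "f \<in> low (Suc m) \<Longrightarrow> cf f m \<noteq> 0 \<Longrightarrow> odeg S x f = m"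
proof -
  assume f: "f \<in> low (Suc m)" "cf f m \<noteq> 0"
  then have "f \<noteq> 0" by auto
  moreover have "Max {k. cf f k \<noteq> 0} = m"
    by (rule Max_eqI) (use f cf_props(1) in \<open>auto simp: low_def not_less_eq_eq[symmetric]\<close>)
  ultimately show ?thesis by (simp add: odeg_def)
qed

section \<open>Leading terms of products\<close>

lemma alpha_pow:
  shows apow_S: "s \<in> S \<Longrightarrow> (\<alpha> ^^ n) s \<in> S"
    and apow_add: "s \<in> S \<Longrightarrow> t \<in> S \<Longrightarrow> (\<alpha> ^^ n) (s + t) = (\<alpha> ^^ n) s + (\<alpha> ^^ n) t"
    and apow_mult: "s \<in> S \<Longrightarrow> t \<in> S \<Longrightarrow> (\<alpha> ^^ n) (s * t) = (\<alpha> ^^ n) s * (\<alpha> ^^ n) t"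
    and apow_surj: "t \<in> S \<Longrightarrow> \<exists>s\<in>S. t = (\<alpha> ^^ n) s"
    and apow_inj: "s \<in> S \<Longrightarrow> t \<in> S \<Longrightarrow> (\<alpha> ^^ n) s = (\<alpha> ^^ n) t \<Longrightarrow> s = t"
proof -
  have bij: "bij_betw \<alpha> S S" and hom: "\<And>a b. a \<in> S \<Longrightarrow> b \<in> S \<Longrightarrow> \<alpha> (a + b) = \<alpha> a + \<alpha> b \<and> \<alpha> (a * b) = \<alpha> a * \<alpha> b"
    using ore by (auto simp: ore_extension_def ring_automorphism_on_def)
  have aS: "\<And>s. s \<in> S \<Longrightarrow> \<alpha> s \<in> S" using bij by (auto simp: bij_betw_def)
  show S: "(\<alpha> ^^ n) s \<in> S" if "s \<in> S" for n s using that by (induction n) (auto intro: aS)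
  show "(\<alpha> ^^ n) (s + t) = (\<alpha> ^^ n) s + (\<alpha> ^^ n) t" if "s \<in> S" "t \<in> S"
    by (induction n) (use that S hom in auto)
  show "(\<alpha> ^^ n) (s * t) = (\<alpha> ^^ n) s * (\<alpha> ^^ n) t" if "s \<in> S" "t \<in> S"
    by (induction n) (use that S hom in auto)
  have b: "bij_betw (\<alpha> ^^ n) S S"
  proof (induction n)
    case 0 show ?case by (simp add: bij_betw_def)
  next
    case (Suc n) then show ?case unfolding funpow.simps using bij by (rule bij_betw_trans)
  qed
  show "\<exists>s\<in>S. t = (\<alpha> ^^ n) s" if "t \<in> S"
    using b that by (auto simp: bij_betw_def)
  show "s = t" if "s \<in> S" "t \<in> S" "(\<alpha> ^^ n) s = (\<alpha> ^^ n) t"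
    using b that by (auto simp: bij_betw_def inj_on_def)
qed

lemma apow_zero [simp]: "(\<alpha> ^^ n) 0 = 0"
  using apow_add[OF S_zero S_zero, of n] by simp

lemma apow_eq_zero: "s \<in> S \<Longrightarrow> (\<alpha> ^^ n) s = 0 \<longleftrightarrow> s = 0"
  using apow_inj[OF _ S_zero, of s n] by auto

lemma x_mult_low:
  assumes "f \<in> low (Suc m)"
  shows "x * f \<in> low (Suc (Suc m))" "cf (x * f) (Suc m) = \<alpha> (cf f m)"
proof -
  have xs: "x * s = \<alpha> s * x + \<delta> s" "\<alpha> s \<in> S" "\<delta> s \<in> S" if "s \<in> S" for s
    using ore that apow_S[of s 1] by (auto simp: ore_extension_def alpha_derivation_def)
  have "x * f = (\<Sum>k<Suc m. x * (cf f k * x ^ k))"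
    using low_expand[OF assms] by (simp only: flip: sum_distrib_left)
  also have "\<dots> = (\<Sum>k<Suc m. \<alpha> (cf f k) * x ^ Suc k + \<delta> (cf f k) * x ^ k)"
    by (rule sum.cong) (simp_all add: xs cf_S mult.assoc[symmetric] distrib_right power_commutes
        del: power_Suc, simp_all add: mult.assoc)
  finally have e: "x * f = (\<Sum>k<Suc m. \<alpha> (cf f k) * x ^ Suc k + \<delta> (cf f k) * x ^ k)" .
  \<comment> \<open>The k-th term of f contributes only in degrees k and k + 1, so nothing lies
    above degree m + 1, and only k = m reaches m + 1.\<close>
  have c: "cf (x * f) j = (\<Sum>k<Suc m. (if j = Suc k then \<alpha> (cf f k) else 0) + (if j = k then \<delta> (cf f k) else 0))" for j
    unfolding e cf_sum cf_add
    by (rule sum.cong) (simp_all add: cf_monom xs cf_S del: power_Suc)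
  show "x * f \<in> low (Suc (Suc m))" unfolding low_def
    by (intro CollectI allI impI, subst c, rule sum.neutral) auto
  show "cf (x * f) (Suc m) = \<alpha> (cf f m)"
    unfolding c by (simp add: sum.distrib)
qed

lemma xpow_mult_low:
  assumes "f \<in> low (Suc m)"
  shows "x ^ n * f \<in> low (Suc (n + m)) \<and> cf (x ^ n * f) (n + m) = (\<alpha> ^^ n) (cf f m)"
proof (induction n)
  case 0 then show ?case using assms by simp
next
  case (Suc n)
  then show ?case using x_mult_low[of "x ^ n * f" "n + m"] by (simp add: mult.assoc)
qed

text \<open>The bounds are asymmetric on purpose: degree below n times degree at most m gives degree
  below n + m. With n = 0 this covers the zero factor.\<close>

lemma mult_low:
  assumes "f \<in> low n" "g \<in> low (Suc m)"
  shows "f * g \<in> low (n + m)"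
proof -
  have 1: "f * g = (\<Sum>k<n. cf f k * (x ^ k * g))"
    using arg_cong[OF low_expand[OF assms(1)], of "\<lambda>z. z * g"]
    by (simp only: mult.assoc sum_distrib_right)
  have "x ^ k * g \<in> low (n + m)" if "k < n" for k
  proof (rule low_mono)
    show "Suc (k + m) \<le> n + m" using that by simp
    show "x ^ k * g \<in> low (Suc (k + m))" using xpow_mult_low[OF assms(2), of k] by simp
  qed
  then have "cf f k * (x ^ k * g) \<in> low (n + m)" if "k \<in> {..<n}" for k
    using low_smult[OF cf_S] that by blast
  then show ?thesis unfolding 1 by (rule low_sum)
qed

text \<open>Removing the top term from f leaves a factor in \<open>low n\<close>, whose product with
  g does not reach degree n + m.\<close>

lemma cf_mult_top:
  assumes "f \<in> low (Suc n)" "g \<in> low (Suc m)"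
  shows "cf (f * g) (n + m) = cf f n * (\<alpha> ^^ n) (cf g m)"
proof -
  define f0 where "f0 = f - cf f n * x ^ n"
  have "f0 \<in> low n" unfolding f0_def low_Suc_iff[of _ n]
    using assms(1) by (auto simp: low_def cf_diff cf_monom cf_S)
  from mult_low[OF this assms(2)] have "cf (f0 * g) (n + m) = 0" by (simp add: low_def)
  moreover have "f * g = f0 * g + cf f n * (x ^ n * g)"
    by (simp add: f0_def algebra_simps)
  ultimately show ?thesis
    using xpow_mult_low[OF assms(2), of n] by (simp add: cf_add cf_smult cf_S)
qed

text \<open>Surjectivity of \<alpha> allows the leading term to be written with its coefficient on
  the right. In a product f * g that coefficient then acts directly on g, which is what makes
  top-faithfulness of g applicable.\<close>

lemma right_top:
  assumes "f \<in> low (Suc n)"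
  obtains s where "s \<in> S" "cf f n = (\<alpha> ^^ n) s" "f - x ^ n * s \<in> low n"
proof -
  obtain s where s: "s \<in> S" "cf f n = (\<alpha> ^^ n) s" using apow_surj cf_S by blast
  have "x ^ n * s \<in> low (Suc n)" "cf (x ^ n * s) n = (\<alpha> ^^ n) s"
    using xpow_mult_low[OF low_const[OF s(1)], of n] s(1) by (auto simp: cf_const)
  then have "f - x ^ n * s \<in> low n"
    using assms s by (simp add: low_Suc_iff[of _ n] low_diff cf_diff)
  with s that show ?thesis by blast
qed

text \<open>The converse implication is automatic, because left multiplication by S acts
  coefficientwise. If the coefficient in degree m vanishes, then s = 1 shows f = 0; hence a non-zero
  top-faithful f has degree exactly m.\<close>

definition topfaithful :: "'a \<Rightarrow> nat \<Rightarrow> bool" where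
  "topfaithful f m \<longleftrightarrow> f \<in> low (Suc m) \<and> (\<forall>s\<in>S. s * cf f m = 0 \<longrightarrow> s * f = 0)"

lemma topfaithful_smult:
  assumes "topfaithful f m" "s \<in> S" shows "topfaithful (s * f) m"
  using assms unfolding topfaithful_def
  by (metis S_mult cf_smult low_smult mult.assoc)

lemma topfaithful_reduce:
  assumes V: "topfaithful V n" and W: "topfaithful W m"
    and eq: "\<And>s. s \<in> S \<Longrightarrow> s * cf V n = 0 \<longleftrightarrow> s * cf W m = 0"
    and q: "q * V \<in> low (n + k)"
  shows "\<exists>q'\<in>low k. q * V = q' * V \<and> q * W = q' * W"
proof -
  obtain N where "q \<in> low N" using low_exists by blast
  with q show ?thesis
  proof (induction N arbitrary: q)
    case 0
    then show ?case using low_mono[of 0 k] by blast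
  next
    case (Suc N)
    show ?case
    proof (cases "Suc N \<le> k")
      case True
      then show ?thesis using Suc.prems(2) low_mono by blast
    next
      case False
      obtain s where s: "s \<in> S" "cf q N = (\<alpha> ^^ N) s" "q - x ^ N * s \<in> low N"
        using right_top[OF Suc.prems(2)] .
      have "cf (q * V) (N + n) = 0" using Suc.prems(1) False by (auto simp: low_def)
      then have "(\<alpha> ^^ N) (s * cf V n) = 0"
        using cf_mult_top[OF Suc.prems(2), of V n] V s by (simp add: topfaithful_def apow_mult cf_S)
      then have "s * cf V n = 0" using s by (simp add: apow_eq_zero S_mult cf_S)
      then have k: "s * V = 0" "s * W = 0"
        using V W eq s(1) by (auto simp: topfaithful_def)
      then have e: "(q - x ^ N * s) * V = q * V" "(q - x ^ N * s) * W = q * W"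
        by (simp_all add: left_diff_distrib mult.assoc)
      then have "\<exists>q'\<in>low k. (q - x ^ N * s) * V = q' * V \<and> (q - x ^ N * s) * W = q' * W"
        using Suc.IH[OF _ s(3)] Suc.prems(1) by simp
      then show ?thesis by (simp add: e)
    qed
  qed
qed

text \<open>For k = 0 the reduced multiplier lies in \<open>low 0\<close>, so it is 0. Thus equality
  of annihilators in S, tested on leading coefficients, extends to the whole Ore extension.\<close>

lemma topfaithful_annihilator:
  assumes "topfaithful V n" "topfaithful W m"
    and "\<And>s. s \<in> S \<Longrightarrow> s * cf V n = 0 \<longleftrightarrow> s * cf W m = 0" and "q * V = 0"
  shows "q * W = 0"
  using topfaithful_reduce[OF assms(1-3), of q 0] assms(4) low_zero by (auto simp: low_0)

lemma topfaithful_low: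
  assumes "topfaithful V n" "topfaithful W m"
    and "\<And>s. s \<in> S \<Longrightarrow> s * cf V n = 0 \<longleftrightarrow> s * cf W m = 0" and "q * V \<in> low (n + k)"
  shows "q * W \<in> low (m + k)"
proof -
  obtain q' where "q' \<in> low k" "q * W = q' * W" using topfaithful_reduce[OF assms] by blast
  then show ?thesis using mult_low[of q' k W m] assms(2) by (simp add: topfaithful_def add.commute)
qed

end

section \<open>Nice elements and special subextensions\<close>

text \<open>Here \<open>A\<close> is the special subextension, called \<open>At\<close> in the
  theorem; the nicely essential subring of the theorem appears below as \<open>C\<close>.\<close>

locale special_ext = ore S \<alpha> \<delta> x
  for S :: "'a::ring_1 set" and \<alpha> \<delta> :: "'a \<Rightarrow> 'a" and x :: 'a +
  fixes R T A :: "'a set" and ups :: "nat \<Rightarrow> 'a" and B :: "nat \<Rightarrow> 'a set" and am :: "nat \<Rightarrow> 'a \<Rightarrow> 'a"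
  assumes U: "setting_U R S T \<alpha> \<delta> x"
    and lann_nice: "\<And>p. p \<in> S \<Longrightarrow> R_nice R S T x p \<Longrightarrow> lann S p = sumprod S (lann R p)"
    and spec: "special_subext R S x A ups B am"
    and ex_nice: "\<And>a. a \<in> R \<Longrightarrow> a \<noteq> 0 \<Longrightarrow>
               \<exists>f \<in> {g * a | g. g \<in> A}. R_nice R S T x f \<and> odeg S x f = dA S x A"
begin

abbreviation d :: nat where "d \<equiv> dA S x A"
abbreviation DegA :: "nat set" where "DegA \<equiv> Deg S x A"
abbreviation rc :: "'a \<Rightarrow> nat \<Rightarrow> 'a \<Rightarrow> 'a" where "rc f n l \<equiv> rcoeff R T (cf f n) l"
abbreviation Rnice :: "'a \<Rightarrow> bool" where "Rnice \<equiv> R_nice R S T x"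

lemma R_ring: "is_subring R" and R_S: "r \<in> R \<Longrightarrow> r \<in> S" and basis: "free_left_basis R S T"
  using U by (auto simp: setting_U_def)

lemma A_ring: "is_subring A" and R_A: "r \<in> R \<Longrightarrow> r \<in> A"
  using spec unfolding special_subext_def by blast+

lemmas R_mult = is_subringD(4)[OF R_ring]
lemmas A_mult = is_subringD(4)[OF A_ring]
lemmas A_diff = is_subringD(3)[OF A_ring]

section \<open>Coefficients over R and nice multiples\<close>

definition rrep :: "'a \<Rightarrow> ('a \<Rightarrow> 'a) \<Rightarrow> bool" where
  "rrep s c \<longleftrightarrow> finite {l. c l \<noteq> 0} \<and> {l. c l \<noteq> 0} \<subseteq> T \<and> (\<forall>l. c l \<in> R) \<and>
                  s = (\<Sum>l | c l \<noteq> 0. c l * l)"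

lemma rrep_ex1: "s \<in> S \<Longrightarrow> \<exists>!c. rrep s c"
  using basis unfolding free_left_basis_def rrep_def by blast

lemma rrep_rcoeff: "s \<in> S \<Longrightarrow> rrep s (rcoeff R T s)"
  using theI'[OF rrep_ex1] unfolding rrep_def rcoeff_def by simp

lemma rcoeff_unique: "s \<in> S \<Longrightarrow> rrep s c \<Longrightarrow> rcoeff R T s = c"
  using rrep_ex1 rrep_rcoeff by blast

lemma rcoeff_R: "s \<in> S \<Longrightarrow> rcoeff R T s l \<in> R"
  and finite_rcoeff: "s \<in> S \<Longrightarrow> finite {l. rcoeff R T s l \<noteq> 0}"
  using rrep_rcoeff unfolding rrep_def by blast+

lemma rcoeff_zero_iff: "s \<in> S \<Longrightarrow> (\<forall>l. rcoeff R T s l = 0) \<longleftrightarrow> s = 0"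
proof
  assume s: "s \<in> S" "\<forall>l. rcoeff R T s l = 0"
  then have "s = (\<Sum>l | rcoeff R T s l \<noteq> 0. rcoeff R T s l * l)"
    using rrep_rcoeff[of s] unfolding rrep_def by blast
  also have "\<dots> = 0" using s(2) by simp
  finally show "s = 0" .
next
  have "rrep 0 (\<lambda>_. 0)" by (simp add: rrep_def is_subringD(5)[OF R_ring])
  then show "s = 0 \<Longrightarrow> \<forall>l. rcoeff R T s l = 0" using rcoeff_unique[OF S_zero] by simp
qed

lemma rcoeff_smult:
  assumes "r \<in> R" "s \<in> S" shows "rcoeff R T (r * s) l = r * rcoeff R T s l"
proof -
  let ?c = "rcoeff R T s"
  have c: "rrep s ?c" using rrep_rcoeff assms(2) .
  have sub: "{l. r * ?c l \<noteq> 0} \<subseteq> {l. ?c l \<noteq> 0}" by auto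
  have fin: "finite {l. ?c l \<noteq> 0}" using finite_rcoeff assms(2) .
  have "s = (\<Sum>l | ?c l \<noteq> 0. ?c l * l)" using c by (simp only: rrep_def)
  then have "r * s = r * (\<Sum>l | ?c l \<noteq> 0. ?c l * l)" by (rule arg_cong)
  also have "\<dots> = (\<Sum>l | ?c l \<noteq> 0. (r * ?c l) * l)"
    by (simp only: sum_distrib_left mult.assoc)
  also have "\<dots> = (\<Sum>l | r * ?c l \<noteq> 0. (r * ?c l) * l)"
    by (rule sum.mono_neutral_right[OF fin sub]) auto
  finally have "r * s = (\<Sum>l | r * ?c l \<noteq> 0. (r * ?c l) * l)" .
  moreover have "finite {l. r * ?c l \<noteq> 0}" using finite_subset[OF sub fin] .
  moreover have "{l. r * ?c l \<noteq> 0} \<subseteq> T" using c sub unfolding rrep_def by blast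
  moreover have "\<forall>l. r * ?c l \<in> R" using R_mult assms rcoeff_R by blast
  ultimately have "rrep (r * s) (\<lambda>l. r * ?c l)" unfolding rrep_def by blast
  with rcoeff_unique S_mult R_S assms show ?thesis by metis
qed

lemma rc_smult: "r \<in> R \<Longrightarrow> rc (r * f) n l = r * rc f n l"
  by (simp add: cf_smult R_S rcoeff_smult cf_S)

lemma rc_zero_iff: "(\<forall>n l. rc f n l = 0) \<longleftrightarrow> f = 0"
proof
  assume "\<forall>n l. rc f n l = 0"
  then have "\<forall>n. cf f n = 0" using rcoeff_zero_iff[OF cf_S] by blast
  then show "f = 0" using low_0[of f] by (simp add: low_def)
next
  show "f = 0 \<Longrightarrow> \<forall>n l. rc f n l = 0" using rcoeff_zero_iff[OF S_zero] by simp
qed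

lemma finite_rc: "finite {(n, l). rc f n l \<noteq> 0}"
proof (rule finite_subset)
  show "{(n, l). rc f n l \<noteq> 0} \<subseteq> (SIGMA n:{n. cf f n \<noteq> 0}. {l. rc f n l \<noteq> 0})"
    using rcoeff_zero_iff[OF S_zero] by auto
  show "finite \<dots>"
    by (intro finite_SigmaI cf_props(1) finite_rcoeff cf_S)
qed

text \<open>Among the non-zero multiples r * f, one with the fewest non-zero R-coefficients is nice:
  if z in R killed one of these coefficients but not another, z * (r * f) would be non-zero with
  fewer.\<close>

lemma nice_multiple:
  assumes "f \<noteq> 0" shows "\<exists>r\<in>R. Rnice (r * f)"
proof -
  define P where "P k \<longleftrightarrow> (\<exists>r\<in>R. r * f \<noteq> 0 \<and> card {(n, l). rc (r * f) n l \<noteq> 0} = k)" for k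
  have "\<exists>k. P k" unfolding P_def using assms is_subringD(1)[OF R_ring] by (metis mult_1)
  then obtain k where k: "P k" and least: "\<And>j. j < k \<Longrightarrow> \<not> P j"
    using exists_least_iff[of P] by blast
  obtain r where r: "r \<in> R" "r * f \<noteq> 0" "card {(n, l). rc (r * f) n l \<noteq> 0} = k"
    using k unfolding P_def by blast
  let ?f = "r * f"
  have kill: "z * rc ?f n' l' = 0" if "z \<in> R" "rc ?f n l \<noteq> 0" "z * rc ?f n l = 0" for z n l n' l'
  proof (rule ccontr)
    assume nz: "z * rc ?f n' l' \<noteq> 0"
    have e: "rc (z * ?f) i j = z * rc ?f i j" for i j using rc_smult that(1) by blast
    have "{(n, l). rc (z * ?f) n l \<noteq> 0} \<subset> {(n, l). rc ?f n l \<noteq> 0}"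
      using that unfolding e by auto
    then have lt: "card {(n, l). rc (z * ?f) n l \<noteq> 0} < k"
      using psubset_card_mono[OF finite_rc] r(3) by metis
    moreover have "z * ?f \<noteq> 0" using nz rc_zero_iff[of "z * ?f"] e by auto
    ultimately have "P (card {(n, l). rc (z * ?f) n l \<noteq> 0})"
      unfolding P_def by (intro bexI[of _ "z * r"] R_mult that(1) r(1)) (simp add: mult.assoc)
    with least lt show False by blast
  qed
  have "Rnice ?f" unfolding R_nice_def lann_def using r(2) kill by blast
  with r(1) show ?thesis by blast
qed

lemma nice_kill:
  assumes "Rnice f" "rc f n l \<noteq> 0" "z \<in> R" "z * rc f n l = 0"
  shows "z * f = 0"
proof -
  have "z * rc f n' l' = 0" for n' l'
  proof (cases "rc f n' l' = 0")
    case False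
    with assms(1,2) have "lann R (rc f n l) = lann R (rc f n' l')" unfolding R_nice_def by blast
    with assms(3,4) show ?thesis by (auto simp: lann_def)
  qed simp
  then show ?thesis using rc_zero_iff[of "z * f"] rc_smult[OF assms(3)] by simp
qed

text \<open>If z kills a non-zero coefficient of r * f, then z * r kills a non-zero coefficient of
  f, hence all of f.\<close>

lemma nice_smult:
  assumes "Rnice f" "r \<in> R" "r * f \<noteq> 0"
  shows "Rnice (r * f)"
proof -
  have "z * rc (r * f) n' l' = 0" if "z \<in> R" "rc (r * f) n l \<noteq> 0" "z * rc (r * f) n l = 0" for z n l n' l'
  proof -
    have nz: "rc f n l \<noteq> 0" using that(2) rc_smult[OF assms(2), of f n l] by auto
    have "(z * r) * rc f n l = 0" using that(3) rc_smult[OF assms(2)] by (simp add: mult.assoc)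
    from nice_kill[OF assms(1) nz R_mult[OF that(1) assms(2)] this]
    have "z * (r * f) = 0" by (simp add: mult.assoc)
    then show ?thesis using rc_zero_iff[of "z * (r * f)"] rc_smult[OF that(1)] by metis
  qed
  then show ?thesis unfolding R_nice_def lann_def using assms(3) by blast
qed

text \<open>Hypothesis (i) concerns nice elements of S, and every non-zero x-coefficient of a nice f
  is such an element. Its annihilator in R is that of any of its non-zero R-coefficients, since an
  element of R killing one of them kills f.\<close>

lemma nice_annihilator:
  assumes "Rnice f" "rc f n l \<noteq> 0"
  shows "lann S (cf f n) = sumprod S (lann R (rc f n l))"
proof -
  let ?p = "cf f n"
  have "?p \<noteq> 0" using assms(2) rcoeff_zero_iff[OF S_zero] by auto
  \<comment> \<open>The R-coefficients of p, viewed as a constant polynomial, are the coefficients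
    of f in degree n; so p inherits niceness.\<close>
  have "rc ?p k j = (if k = 0 then rc f n j else 0)" for k j
    using rcoeff_zero_iff[OF S_zero] by (simp add: cf_const cf_S)
  then have "rc ?p k j \<noteq> 0 \<Longrightarrow> rc ?p k j = rc f n j" for k j by (simp split: if_splits)
  then have "Rnice ?p" using assms(1) \<open>?p \<noteq> 0\<close> unfolding R_nice_def by metis
  then have "lann S ?p = sumprod S (lann R ?p)" using lann_nice cf_S by blast
  moreover have "z * ?p = 0 \<longleftrightarrow> z * rc f n l = 0" if "z \<in> R" for z
  proof
    assume "z * ?p = 0"
    then show "z * rc f n l = 0"
      using rcoeff_smult[OF that cf_S, of f n l] rcoeff_zero_iff[OF S_zero] by simp
  next
    assume "z * rc f n l = 0"
    then have "z * f = 0" using nice_kill assms that by blast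
    then show "z * ?p = 0" using cf_smult[OF R_S[OF that], of f n] by simp
  qed
  then have "lann R ?p = lann R (rc f n l)" by (auto simp: lann_def)
  ultimately show ?thesis by simp
qed

lemma lann_left_ideal: "is_subring C \<Longrightarrow> left_ideal C (lann C f)"
  by (auto simp: left_ideal_def lann_def distrib_right mult.assoc is_subringD)

text \<open>The annihilator in S of the leading coefficient is generated by elements of R, and these
  kill f by niceness.\<close>

lemma nice_topfaithful:
  assumes "Rnice f" "f \<in> low (Suc m)" "cf f m \<noteq> 0"
  shows "topfaithful f m"
proof -
  obtain l where l: "rc f m l \<noteq> 0" using assms(3) rcoeff_zero_iff[OF cf_S] by blast
  have "lann R (rc f m l) \<subseteq> lann S f" using nice_kill[OF assms(1) l] R_S by (auto simp: lann_def)
  then have "lann S (cf f m) \<subseteq> lann S f"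
    using sumprod_subset[OF lann_left_ideal[OF S_ring]] nice_annihilator[OF assms(1) l] by blast
  then show ?thesis using assms(2) by (auto simp: topfaithful_def lann_def)
qed

section \<open>Shadows in R\<close>

text \<open>The element \<open>c \<in> R\<close> has the same left annihilator as \<open>f\<close>, and left multiplication by any \<open>q\<close> shifts the
  degrees of \<open>c\<close> and \<open>f\<close> by the same amount.\<close>
definition shadow :: "'a \<Rightarrow> nat \<Rightarrow> 'a \<Rightarrow> bool" where
  "shadow f m c \<longleftrightarrow> c \<in> R \<and> Rnice c \<and> topfaithful f m \<and> (\<forall>s\<in>S. s * cf f m = 0 \<longleftrightarrow> s * c = 0)"

lemma shadow_nonzero: "shadow f m c \<Longrightarrow> c \<noteq> 0 \<and> cf f m \<noteq> 0 \<and> f \<noteq> 0"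
proof -
  assume a: "shadow f m c"
  then have "c \<noteq> 0" by (simp add: shadow_def R_nice_def)
  moreover have "cf f m \<noteq> 0" using a S_one \<open>c \<noteq> 0\<close> by (metis mult_1 shadow_def)
  ultimately show ?thesis by auto
qed

lemma shadow_smult:
  assumes "shadow f m c" "r \<in> R" "Rnice (r * c)"
  shows "shadow (r * f) m (r * c)"
proof -
  have "s * cf (r * f) m = 0 \<longleftrightarrow> s * (r * c) = 0" if "s \<in> S" for s
    using assms S_mult[OF that R_S[OF assms(2)]] by (simp add: cf_smult R_S shadow_def flip: mult.assoc)
  then show ?thesis using assms R_mult R_S topfaithful_smult by (simp add: shadow_def)
qed

text \<open>The shadow is a nice multiple r * a of some R-coefficient a of the leading coefficient.
  Hypothesis (i) determines the annihilator in S both of the shadow and of the leading coefficient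
  of r * f, and both are generated by the annihilator of r * a in R.\<close>

lemma nice_shadow:
  assumes "Rnice f" "f \<in> low (Suc m)" "cf f m \<noteq> 0"
  shows "\<exists>r\<in>R. \<exists>c. shadow (r * f) m c"
proof -
  obtain l where l: "rc f m l \<noteq> 0" using assms(3) rcoeff_zero_iff[OF cf_S] by blast
  obtain r where r: "r \<in> R" "Rnice (r * rc f m l)" using nice_multiple l by blast
  let ?c = "r * rc f m l"
  have c: "?c \<in> R" using r R_mult rcoeff_R cf_S by blast
  have rcc: "rc (r * f) m l = ?c" using rc_smult r by blast
  have nz: "?c \<noteq> 0" using r(2) by (simp add: R_nice_def)
  have "r * f \<noteq> 0" using rc_zero_iff[of "r * f"] rcc nz by metis
  then have n: "Rnice (r * f)" using nice_smult assms r by blast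
  have "cf (r * f) m \<noteq> 0" using rcc nz rcoeff_zero_iff[OF S_zero] by auto
  then have "topfaithful (r * f) m" using n nice_topfaithful assms(2) low_smult R_S r(1) by blast
  moreover have "lann S (cf (r * f) m) = lann S ?c"
    using nice_annihilator[OF n, of m l] rcc nz lann_nice[OF R_S[OF c] r(2)] by simp
  ultimately have "shadow (r * f) m ?c" using c r by (auto simp: shadow_def lann_def)
  with r(1) show ?thesis by blast
qed

text \<open>Passing to a nice multiple may kill the leading term, so the degree can drop; that it
  does not grow is what the later inductions use.\<close>

lemma shadow_exists:
  assumes "f \<noteq> 0" "f \<in> low (Suc M)"
  shows "\<exists>r\<in>R. \<exists>m\<le>M. \<exists>c. shadow (r * f) m c"
proof -
  obtain r where r: "r \<in> R" "Rnice (r * f)" using nice_multiple assms by blast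
  obtain m where m: "r * f \<in> low (Suc m)" "cf (r * f) m \<noteq> 0"
    using degree_exists[of "r * f"] r(2) by (auto simp: R_nice_def)
  obtain r' c where c: "r' \<in> R" "shadow (r' * (r * f)) m c" using nice_shadow[OF r(2) m] by blast
  have "r * f \<in> low (Suc M)" using low_smult R_S r assms by blast
  then have "m \<le> M" using m(2) unfolding low_def mem_Collect_eq by (meson not_less_eq_eq)
  moreover have "r' * r \<in> R" "shadow (r' * r * f) m c" using c r R_mult by (auto simp: mult.assoc)
  ultimately show ?thesis by blast
qed

lemma topfaithful_const: "c \<in> S \<Longrightarrow> topfaithful c 0"
  by (simp add: topfaithful_def low_const cf_const)

text \<open>The hypothesis on nice elements of degree d applies to the shadow c and yields G with G
  * c of degree d. As f and c have matching annihilators, multiplying by G moves f up by d as well,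
  and a shadow of G * c serves for G * f.\<close>

lemma shadow_raise:
  assumes "shadow f m c"
  shows "\<exists>g\<in>A. \<exists>c'. shadow (g * f) (m + d) c'"
proof -
  have c: "c \<in> R" "c \<noteq> 0" using assms shadow_nonzero unfolding shadow_def by blast+
  obtain g where g: "g \<in> A" "Rnice (g * c)" "odeg S x (g * c) = d" using ex_nice[OF c] by blast
  then have "g * c \<noteq> 0" by (simp add: R_nice_def)
  then obtain k where "g * c \<in> low (Suc k)" "cf (g * c) k \<noteq> 0" by (rule degree_exists)
  moreover from odeg_eq[OF this] have "k = d" using g(3) by simp
  ultimately have "g * c \<in> low (Suc d)" "cf (g * c) d \<noteq> 0" by auto
  from nice_shadow[OF g(2) this] obtain r c' where r: "r \<in> R" "shadow (r * (g * c)) d c'" by blast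
  define G where "G = r * g"
  have G: "G \<in> A" unfolding G_def using A_mult R_A r(1) g(1) by blast
  have sh: "shadow (G * c) d c'" using r by (simp add: G_def mult.assoc)
  have tf: "topfaithful f m" using assms unfolding shadow_def by blast
  have tc: "topfaithful c 0" using topfaithful_const R_S c(1) by blast
  have eq: "s * cf f m = 0 \<longleftrightarrow> s * cf c 0 = 0" if "s \<in> S" for s
    using assms that c by (simp add: shadow_def cf_const R_S)
  \<comment> \<open>Since c is constant, it is top-faithful in degree 0, and degree bounds for q * f
    and q * c correspond up to the shift by m.\<close>
  have down: "q * f \<in> low (m + k) \<Longrightarrow> q * c \<in> low k" for q k
    using topfaithful_low[OF tf tc eq, where q = q and k = k] by (simp only: add_0)
  have up: "q * c \<in> low k \<Longrightarrow> q * f \<in> low (m + k)" for q k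
    using topfaithful_low[OF tc tf eq[symmetric], where q = q and k = k] by (simp only: add_0)
  have ann: "q * c = 0 \<Longrightarrow> q * f = 0" for q
    using topfaithful_annihilator[OF tc tf eq[symmetric]] .
  have Gc: "G * c \<in> low (Suc d)" "\<And>s. s \<in> S \<Longrightarrow> s * cf (G * c) d = 0 \<Longrightarrow> s * (G * c) = 0"
    using sh unfolding shadow_def topfaithful_def by blast+
  have Gf: "G * f \<in> low (Suc (m + d))" using up[OF Gc(1)] by simp
  \<comment> \<open>That s kills the leading coefficient means that multiplication by s lowers the
    degree; this condition passes between G * f and G * c by \<open>up\<close> and
    \<open>down\<close>.\<close>
  have e: "s * cf (G * f) (m + d) = 0 \<longleftrightarrow> s * cf (G * c) d = 0" if s: "s \<in> S" for s
  proof -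
    have "s * cf (G * f) (m + d) = 0 \<longleftrightarrow> s * G * f \<in> low (m + d)"
      unfolding mult.assoc low_Suc_iff[of "s * (G * f)" "m + d"] cf_smult[OF s]
      using low_smult[OF s Gf] by blast
    also have "\<dots> \<longleftrightarrow> s * G * c \<in> low d" using up[of "s * G" d] down[of "s * G" d] by blast
    also have "\<dots> \<longleftrightarrow> s * cf (G * c) d = 0"
      unfolding mult.assoc low_Suc_iff[of "s * (G * c)" d] cf_smult[OF s]
      using low_smult[OF s Gc(1)] by blast
    finally show ?thesis .
  qed
  have "s * (G * f) = 0" if "s \<in> S" "s * cf (G * f) (m + d) = 0" for s
    using ann[of "s * G"] Gc(2)[OF that(1)] e[OF that(1)] that(2) by (simp add: mult.assoc)
  then have "topfaithful (G * f) (m + d)" unfolding topfaithful_def using Gf by blast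
  then have "shadow (G * f) (m + d) c'" using sh e unfolding shadow_def by blast
  with G show ?thesis by blast
qed

lemma shadow_raise_mult:
  assumes "shadow f m c"
  shows "\<exists>g\<in>A. \<exists>c'. shadow (g * f) (m + d * k) c'"
proof (induction k)
  case 0
  show ?case using assms is_subringD(1)[OF A_ring] by (intro bexI[of _ 1] exI[of _ c]) auto
next
  case (Suc k)
  then obtain g c' where "g \<in> A" "shadow (g * f) (m + d * k) c'" by blast
  moreover from shadow_raise[OF this(2)] obtain h c'' where
    "h \<in> A" "shadow (h * (g * f)) (m + d * k + d) c''" by blast
  ultimately have "h * g \<in> A" "shadow (h * g * f) (m + d * Suc k) c''"
    using A_mult by (simp_all add: algebra_simps)
  then show ?case by blast
qed

section \<open>Leading terms in the special subextension\<close>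

lemma A_component: "f \<in> A \<Longrightarrow> cf f m * x ^ m \<in> A"
proof -
  assume f: "f \<in> A"
  have "A = {y. \<exists>(n::nat) g. (\<forall>m<n. g m \<in> A \<inter> {s * x ^ m | s. s \<in> S}) \<and> y = (\<Sum>m<n. g m)}"
    using spec unfolding special_subext_def by (elim conjE)
  from subsetD[OF equalityD1[OF this] f] obtain n :: nat and g where g: "\<And>m. m < n \<Longrightarrow> g m \<in> A \<inter> {s * x ^ m | s. s \<in> S}" "f = (\<Sum>m<n. g m)"
    by blast
  \<comment> \<open>Each g i is homogeneous of degree exactly i, so it is its own i-th
    component.\<close>
  have gi: "cf (g i) j * x ^ j = (if j = i then g i else 0)" if i: "i < n" for i j
  proof -
    obtain s where "s \<in> S" "g i = s * x ^ i" using g(1)[OF i] by blast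
    then show ?thesis by (simp add: cf_monom)
  qed
  have "cf f m * x ^ m = (\<Sum>i<n. cf (g i) m * x ^ m)"
    unfolding g(2) cf_sum by (simp add: sum_distrib_right)
  also have "\<dots> = (\<Sum>i<n. if m = i then g i else 0)"
    by (rule sum.cong) (use gi in auto)
  also have "\<dots> \<in> A" using g(1) is_subringD(5)[OF A_ring] by auto
  finally show ?thesis .
qed

lemma Deg_multiples: "DegA = {d * k | k. True}"
  using spec unfolding special_subext_def by (elim conjE)

lemma mem_DegA: "f \<in> A \<Longrightarrow> f \<in> low (Suc m) \<Longrightarrow> cf f m \<noteq> 0 \<Longrightarrow> m \<in> DegA"
proof -
  assume f: "f \<in> A" "f \<in> low (Suc m)" "cf f m \<noteq> 0"
  then have "f \<noteq> 0" by auto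
  with f odeg_eq[OF f(2,3)] show ?thesis unfolding Deg_def by blast
qed

text \<open>The definition treats m = 0 separately. Here both cases are merged, and the conditions
  on \<open>ups m * x ^ m\<close> become identities between leading coefficients in S.\<close>

lemma B_facts:
  assumes m: "m \<in> DegA"
  shows lambda_A: "ups m * x ^ m \<in> A" and ups_regular: "regular_in S (ups m)"
    and B_ring: "is_subring (B m)" and R_B: "R \<subseteq> B m" and B_A: "B m \<subseteq> A" and B_S: "B m \<subseteq> S"
    and am_auto: "ring_automorphism_on (B m) (am m)"
    and am_comm: "p \<in> B m \<Longrightarrow> am m p * ups m = ups m * (\<alpha> ^^ m) p"
    and B_multiple: "q \<in> S \<Longrightarrow> q * x ^ m \<in> A \<Longrightarrow> \<exists>u\<in>B m. regular_in S u \<and> (\<exists>b\<in>B m. u * q = b * ups m)"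
proof -
  have sp: "m \<noteq> 0 \<Longrightarrow> ups m * x ^ m \<in> A \<and> regular_in S (ups m) \<and>
        is_subring (B m) \<and> R \<subseteq> B m \<and> B m \<subseteq> A \<inter> S \<and> ring_automorphism_on (B m) (am m) \<and>
        (\<forall>p\<in>B m. odeg S x (ups m * x ^ m * p - am m p * (ups m * x ^ m)) < m) \<and>
        (\<forall>q\<in>S. q * x ^ m \<in> A \<longrightarrow>
           (\<exists>u\<in>B m. regular_in S u \<and> u * q * x ^ m \<in> {b * (ups m * x ^ m) | b. b \<in> B m}))"
    and z: "ups 0 = 1" "B 0 = A \<inter> S" "\<And>p. p \<in> B 0 \<Longrightarrow> am 0 p = p"
    subgoal using spec m unfolding special_subext_def by (elim conjE) blast
    subgoal using spec unfolding special_subext_def by (elim conjE)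
    subgoal using spec unfolding special_subext_def by (elim conjE)
    subgoal using spec unfolding special_subext_def by (elim conjE) blast
    done
  have one: "1 \<in> A" "1 \<in> S" using A_ring S_one by (auto simp: is_subring_def)
  have p: "m \<noteq> 0 \<Longrightarrow> ups m * x ^ m \<in> A" "m \<noteq> 0 \<Longrightarrow> regular_in S (ups m)"
    "m \<noteq> 0 \<Longrightarrow> is_subring (B m)" "m \<noteq> 0 \<Longrightarrow> R \<subseteq> B m" "m \<noteq> 0 \<Longrightarrow> B m \<subseteq> A \<inter> S"
    "m \<noteq> 0 \<Longrightarrow> ring_automorphism_on (B m) (am m)"
    using sp by blast+
  show "ups m * x ^ m \<in> A" using p(1) z(1) one by (cases "m = 0") simp_all
  show reg: "regular_in S (ups m)" using p(2) z(1) regular_in_one[OF S_ring] by (cases "m = 0") simp_all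
  have "is_subring (A \<inter> S)" using A_ring S_ring by (auto simp: is_subring_def)
  then have B0: "is_subring (B 0)" by (simp only: z(2))
  then show "is_subring (B m)" using p(3) by (cases "m = 0") simp_all
  have "R \<subseteq> B 0" using z(2) R_S R_A by blast
  then show "R \<subseteq> B m" using p(4) by (cases "m = 0") simp_all
  have "B m \<subseteq> A \<inter> S" using p(5) z(2) by (cases "m = 0") simp_all
  then show BA: "B m \<subseteq> A" and BS: "B m \<subseteq> S" by blast+
  have "bij_betw (am 0) (B 0) (B 0)"
    using bij_betw_cong[of "B 0" "am 0" id "B 0"] z(3) by simp
  then have "ring_automorphism_on (B 0) (am 0)"
    using is_subringD[OF B0] unfolding ring_automorphism_on_def by (simp add: z(3))
  then show aut: "ring_automorphism_on (B m) (am m)" using p(6) by (cases "m = 0") simp_all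
  have upsS: "ups m \<in> S" using reg by (simp add: regular_in_def)
  show "am m p * ups m = ups m * (\<alpha> ^^ m) p" if p: "p \<in> B m"
  proof (cases "m = 0")
    case True then show ?thesis using z p by simp
  next
    case False
    let ?h = "ups m * x ^ m * p - am m p * (ups m * x ^ m)"
    have amS: "am m p \<in> S" using aut p BS unfolding ring_automorphism_on_def bij_betw_def by blast
    \<comment> \<open>If h = 0 then \<open>odeg\<close> takes its default value 0, which is below m
      as m is non-zero here. In either case the coefficient of h in degree m vanishes.\<close>
    have "odeg S x ?h < m" using sp False p by blast
    then have "cf ?h m = 0"
      using Max_ge[OF cf_props(1), of m ?h] by (auto simp: odeg_def split: if_splits)
    moreover have "cf (ups m * x ^ m * p) (m + 0) = ups m * (\<alpha> ^^ m) p"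
      using cf_mult_top[of "ups m * x ^ m" m p 0] p BS upsS
      by (auto simp: low_def cf_monom cf_const low_const)
    moreover have "cf (am m p * (ups m * x ^ m)) m = am m p * ups m"
      using cf_smult[OF amS, of "ups m * x ^ m" m] cf_monom[OF upsS, of m m] by simp
    ultimately show ?thesis by (simp add: cf_diff)
  qed
  show "\<exists>u\<in>B m. regular_in S u \<and> (\<exists>b\<in>B m. u * q = b * ups m)" if q: "q \<in> S" "q * x ^ m \<in> A"
  proof (cases "m = 0")
    case True then show ?thesis
      using q z(1,2) one regular_in_one[OF S_ring] by (intro bexI[of _ 1] conjI bexI[of _ q]) simp_all
  next
    case False
    then obtain u b where u: "u \<in> B m" "regular_in S u" "b \<in> B m" "u * q * x ^ m = b * (ups m * x ^ m)"
      using sp q by blast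
    have "u * q \<in> S" "b * ups m \<in> S" using u BS q upsS S_mult by blast+
    then have "u * q = b * ups m"
      using cf_monom[of "u * q" m m] cf_monom[of "b * ups m" m m] u(4) by (simp add: mult.assoc)
    with u show ?thesis by blast
  qed
qed

lemma lambda_mult:
  assumes "m \<in> DegA" "s \<in> S"
  shows "ups m * x ^ m * s \<in> low (Suc m)" "cf (ups m * x ^ m * s) m = ups m * (\<alpha> ^^ m) s"
proof -
  have u: "ups m \<in> S" using ups_regular[OF assms(1)] by (simp add: regular_in_def)
  then have l: "ups m * x ^ m \<in> low (Suc m)" by (auto simp: low_def cf_monom)
  show "ups m * x ^ m * s \<in> low (Suc m)"
    using mult_low[OF l low_const[OF assms(2)]] by simp
  show "cf (ups m * x ^ m * s) m = ups m * (\<alpha> ^^ m) s"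
    using cf_mult_top[OF l low_const[OF assms(2)]] u assms(2) by (simp add: cf_monom cf_const)
qed

lemma ups_cancel:
  assumes "m \<in> DegA" "s \<in> S" "ups m * (\<alpha> ^^ m) s = 0" shows "s = 0"
  using assms ups_regular[OF assms(1)] apow_S[OF assms(2)] by (auto simp: regular_in_def apow_eq_zero)

lemma am_surj: "m \<in> DegA \<Longrightarrow> b \<in> B m \<Longrightarrow> \<exists>b'\<in>B m. b = am m b'"
  using am_auto[of m] by (auto simp: ring_automorphism_on_def bij_betw_def)

lemma am_B: "m \<in> DegA \<Longrightarrow> b \<in> B m \<Longrightarrow> am m b \<in> B m"
  using am_auto[of m] by (auto simp: ring_automorphism_on_def bij_betw_def)

text \<open>A common denominator for the leading terms of finitely many elements of A: after
  multiplication by one regular u they all have the form \<open>ups m * x ^ m * b\<close> with b in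
  \<open>B m\<close>, up to lower degree. Coefficients can be moved to the right because
  \<open>am m\<close> is onto.\<close>

lemma common_top:
  fixes a :: "nat \<Rightarrow> 'a"
  assumes m: "m \<in> DegA" and a: "\<And>i. i < n \<Longrightarrow> a i \<in> A" "\<And>i. i < n \<Longrightarrow> a i \<in> low (Suc m)"
  shows "\<exists>u\<in>B m. regular_in S u \<and> (\<exists>b. \<forall>i<n. b i \<in> B m \<and> u * a i - ups m * x ^ m * b i \<in> low m)"
  using a
proof (induction n)
  case 0
  show ?case
    using is_subringD(1)[OF B_ring[OF m]] regular_in_one[OF S_ring]
    by (intro bexI[of _ 1] conjI exI[of _ "\<lambda>_. 0"]) simp_all
next
  case (Suc n)
  have "\<exists>u\<in>B m. regular_in S u \<and> (\<exists>b. \<forall>i<n. b i \<in> B m \<and> u * a i - ups m * x ^ m * b i \<in> low m)"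
    by (rule Suc.IH) (use Suc.prems in simp_all)
  then obtain u b where u: "u \<in> B m" "regular_in S u"
    and b: "\<forall>i<n. b i \<in> B m \<and> u * a i - ups m * x ^ m * b i \<in> low m"
    by blast
  define lam where "lam = ups m * x ^ m"
  note BS = subsetD[OF B_S[OF m]] and BA = subsetD[OF B_A[OF m]] and Bm = is_subringD(4)[OF B_ring[OF m]]
  have lam: "lam * s \<in> low (Suc m)" "cf (lam * s) m = ups m * (\<alpha> ^^ m) s" if "s \<in> S" for s
    using lambda_mult[OF m that] by (simp_all add: lam_def)
  have "u * a n \<in> A" using A_mult BA[OF u(1)] Suc.prems(1)[of n] by simp
  from B_multiple[OF m cf_S A_component[OF this]]
  obtain v c where v: "v \<in> B m" "regular_in S v" "c \<in> B m" "v * cf (u * a n) m = c * ups m" by blast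
  obtain c' where c': "c' \<in> B m" "c = am m c'" using am_surj[OF m v(3)] by blast
  \<comment> \<open>The denominator v of the new element also multiplies the earlier ones. Moved
    past \<open>ups m * x ^ m\<close> it becomes v', which changes their coefficients b i to v' * b
    i.\<close>
  obtain v' where v': "v' \<in> B m" "v = am m v'" using am_surj[OF m v(1)] by blast
  have S: "v \<in> S" "v' \<in> S" "u \<in> S" "c' \<in> S" using BS u(1) v(1) v'(1) c'(1) by blast+
  define b2 where "b2 i = (if i < n then v' * b i else c')" for i
  have "b2 i \<in> B m \<and> v * u * a i - lam * b2 i \<in> low m" if "i < Suc n" for i
  proof (cases "i < n")
    case True
    then have bi: "b i \<in> B m" "u * a i - lam * b i \<in> low m" using b by (auto simp: lam_def)
    have S2: "b i \<in> S" "v' * b i \<in> S" using BS[OF bi(1)] S_mult S(2) by blast+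
    have 1: "v * (u * a i - lam * b i) \<in> low m" using low_smult[OF S(1) bi(2)] .
    have "v * (lam * b i) - lam * (v' * b i) \<in> low (Suc m)"
      by (rule low_diff[OF low_smult[OF S(1) lam(1)[OF S2(1)]] lam(1)[OF S2(2)]])
    moreover have "cf (v * (lam * b i) - lam * (v' * b i)) m = 0"
      unfolding cf_diff cf_smult[OF S(1)] lam(2)[OF S2(1)] lam(2)[OF S2(2)] apow_mult[OF S(2) S2(1)]
      using am_comm[OF m v'(1)] v'(2) by (metis diff_self mult.assoc)
    ultimately have "v * (lam * b i) - lam * (v' * b i) \<in> low m" using low_Suc_iff by blast
    from low_add[OF 1 this] have "v * u * a i - lam * (v' * b i) \<in> low m"
      by (simp add: right_diff_distrib mult.assoc)
    then show ?thesis using True Bm[OF v'(1) bi(1)] by (simp add: b2_def)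
  next
    case False
    with that have i: "i = n" by simp
    have an: "u * a n \<in> low (Suc m)" using low_smult[OF S(3)] Suc.prems(2)[of n] by simp
    have "v * (u * a n) - lam * c' \<in> low (Suc m)"
      by (rule low_diff[OF low_smult[OF S(1) an] lam(1)[OF S(4)]])
    moreover have "cf (v * (u * a n) - lam * c') m = 0"
      unfolding cf_diff cf_smult[OF S(1)] lam(2)[OF S(4)] v(4) c'(2) am_comm[OF m c'(1)] by simp
    ultimately have "v * (u * a n) - lam * c' \<in> low m" using low_Suc_iff by blast
    then show ?thesis using i c'(1) by (simp add: b2_def mult.assoc)
  qed
  moreover have "v * u \<in> B m" "regular_in S (v * u)"
    using Bm[OF v(1) u(1)] regular_in_mult[OF S_ring v(2) u(2)] by auto
  ultimately show ?case unfolding lam_def by (intro bexI[of _ "v * u"] conjI exI[of _ b2]) simp_all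
qed

text \<open>The a i may have larger degree than the sum, because top terms cancel. After clearing
  denominators, the top of the sum is \<open>ups M * x ^ M * s\<close> with s the sum of the b i * l
  i. Cancellation forces s = 0, so the top terms can be subtracted from all the multiplied
  coefficients without changing the multiplied sum.\<close>

lemma reduce_degrees:
  fixes a l :: "nat \<Rightarrow> 'a"
  assumes l: "\<And>i. i < n \<Longrightarrow> l i \<in> S"
  shows "(\<And>i. i < n \<Longrightarrow> a i \<in> A \<and> a i \<in> low (Suc (m + N))) \<Longrightarrow> (\<Sum>i<n. a i * l i) \<in> low (Suc m) \<Longrightarrow>
    \<exists>u\<in>A \<inter> S. regular_in S u \<and>
      (\<exists>a'. (\<forall>i<n. a' i \<in> A \<and> a' i \<in> low (Suc m)) \<and> u * (\<Sum>i<n. a i * l i) = (\<Sum>i<n. a' i * l i))"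
proof (induction N arbitrary: a)
  case 0
  then show ?case
    using is_subringD(1)[OF A_ring] S_one regular_in_one[OF S_ring]
    by (intro bexI[of _ 1] conjI exI[of _ a]) auto
next
  case (Suc N)
  let ?M = "m + Suc N"
  let ?f = "\<Sum>i<n. a i * l i"
  show ?case
  proof (cases "?M \<in> DegA")
    \<comment> \<open>Elements of A cannot have degree M in this case, so the bound on the
      coefficients drops without any multiplication.\<close>
    case False
    then have "a i \<in> low (Suc (m + N))" if "i < n" for i
      using Suc.prems(1)[OF that] mem_DegA[of "a i" ?M] low_Suc_iff[of "a i" ?M] by auto
    then show ?thesis using Suc by blast
  next
    case True
    note BS = subsetD[OF B_S[OF True]] and BA = subsetD[OF B_A[OF True]]
    obtain u b where u: "u \<in> B ?M" "regular_in S u"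
      and b: "\<And>i. i < n \<Longrightarrow> b i \<in> B ?M \<and> u * a i - ups ?M * x ^ ?M * b i \<in> low ?M"
      using common_top[OF True, of n a] Suc.prems(1) by blast
    define a2 where "a2 i = u * a i - ups ?M * x ^ ?M * b i" for i
    define s where "s = (\<Sum>i<n. b i * l i)"
    have sS: "s \<in> S" unfolding s_def using b BS l S_mult by (auto intro!: is_subring_sum[OF S_ring])
    have a2: "a2 i \<in> A \<and> a2 i \<in> low (Suc (m + N))" if "i < n" for i
      using b[OF that] Suc.prems(1)[OF that] u BA A_mult A_diff lambda_A[OF True] by (auto simp: a2_def)
    have e: "u * ?f = ups ?M * x ^ ?M * s + (\<Sum>i<n. a2 i * l i)"
      unfolding s_def a2_def
      by (simp add: sum_distrib_left left_diff_distrib sum_subtractf mult.assoc)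
    have "(\<Sum>i<n. a2 i * l i) \<in> low (Suc (m + N))"
      using a2 mult_low[of _ "Suc (m + N)" _ 0] low_const l by (intro low_sum) auto
    then have "cf (\<Sum>i<n. a2 i * l i) ?M = 0" by (simp add: low_def)
    moreover have uf: "u * ?f \<in> low (Suc m)" using Suc.prems(2) low_smult BS u by blast
    then have "cf (u * ?f) ?M = 0" by (simp add: low_def)
    ultimately have "cf (ups ?M * x ^ ?M * s) ?M = 0" using e by (simp only: cf_add add_0_right)
    \<comment> \<open>\<open>ups\<close> is regular and the powers of \<alpha> are injective, so
      vanishing of the top coefficient gives s = 0.\<close>
    then have "s = 0" using ups_cancel[OF True sS] lambda_mult(2)[OF True sS] by simp
    then have e2: "u * ?f = (\<Sum>i<n. a2 i * l i)" using e by simp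
    obtain v a' where v: "v \<in> A \<inter> S" "regular_in S v" "\<forall>i<n. a' i \<in> A \<and> a' i \<in> low (Suc m)"
      "v * (\<Sum>i<n. a2 i * l i) = (\<Sum>i<n. a' i * l i)"
      using Suc.IH[OF a2] uf e2 by force
    have "v * u \<in> A \<inter> S" "regular_in S (v * u)" "v * u * ?f = (\<Sum>i<n. a' i * l i)"
      using v u BS BA A_mult S_mult regular_in_mult[OF S_ring] e2 by (auto simp: mult.assoc)
    with v(3) show ?thesis by blast
  qed
qed

text \<open>Once all coefficients have degree at most m, a common denominator turns the top of f
  into \<open>ups m * x ^ m\<close> times an element of \<open>B m\<close> L. This is how the
  hypotheses on the left ideals of \<open>B m\<close> come to bear on A L.\<close>

lemma sumprod_top:
  assumes f: "f \<in> sumprod A L" and L: "L \<subseteq> S" and low: "f \<in> low (Suc m)" and m: "m \<in> DegA"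
  shows "\<exists>u\<in>A \<inter> S. regular_in S u \<and> (\<exists>s\<in>sumprod (B m) L. cf (u * f) m = ups m * (\<alpha> ^^ m) s)"
proof -
  obtain n :: nat and a l where al: "\<forall>i<n. a i \<in> A \<and> l i \<in> L" "f = (\<Sum>i<n. a i * l i)"
    using f unfolding sumprod_def by blast
  have lS: "\<And>i. i < n \<Longrightarrow> l i \<in> S" using al L by blast
  have "\<exists>N. \<forall>i<n. a i \<in> low N"
  proof -
    define Nf where "Nf i = (SOME N. a i \<in> low N)" for i
    have Nf: "a i \<in> low (Nf i)" for i unfolding Nf_def by (rule someI_ex[OF low_exists])
    have "a i \<in> low (\<Sum>i<n. Nf i)" if "i < n" for i
    proof (rule low_mono[OF _ Nf])
      show "Nf i \<le> (\<Sum>i<n. Nf i)" using that by (intro member_le_sum) auto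
    qed
    then show ?thesis by blast
  qed
  then obtain N where N: "\<forall>i<n. a i \<in> low N" by blast
  have ai: "a i \<in> A \<and> a i \<in> low (Suc (m + N))" if "i < n" for i
    using al(1) N low_mono[of N "Suc (m + N)" "a i"] that by simp
  have "\<exists>u\<in>A \<inter> S. regular_in S u \<and>
      (\<exists>a'. (\<forall>i<n. a' i \<in> A \<and> a' i \<in> low (Suc m)) \<and> u * (\<Sum>i<n. a i * l i) = (\<Sum>i<n. a' i * l i))"
    by (rule reduce_degrees[where N = N]) (use lS ai low al(2) in simp_all)
  then obtain u a' where u: "u \<in> A \<inter> S" "regular_in S u" "\<forall>i<n. a' i \<in> A \<and> a' i \<in> low (Suc m)"
    "u * f = (\<Sum>i<n. a' i * l i)"
    unfolding al(2) by blast
  obtain v b where v: "v \<in> B m" "regular_in S v"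
      and b: "\<And>i. i < n \<Longrightarrow> b i \<in> B m \<and> v * a' i - ups m * x ^ m * b i \<in> low m"
    using common_top[OF m, of n a'] u(3) by blast
  note BS = subsetD[OF B_S[OF m]] and BA = subsetD[OF B_A[OF m]]
  define a2 where "a2 i = v * a' i - ups m * x ^ m * b i" for i
  define s where "s = (\<Sum>i<n. b i * l i)"
  have sL: "s \<in> sumprod (B m) L" unfolding s_def using b al(1) by (intro sumprod_sum sumprod_prodI) auto
  have sS: "s \<in> S" unfolding s_def using b BS lS S_mult by (auto intro!: is_subring_sum[OF S_ring])
  have e: "v * u * f = ups m * x ^ m * s + (\<Sum>i<n. a2 i * l i)"
    unfolding s_def a2_def mult.assoc[of v] u(4)
    by (simp add: sum_distrib_left left_diff_distrib sum_subtractf mult.assoc)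
  have "(\<Sum>i<n. a2 i * l i) \<in> low m"
    using b mult_low[of _ m _ 0] low_const lS by (intro low_sum) (auto simp: a2_def)
  then have "cf (v * u * f) m = ups m * (\<alpha> ^^ m) s"
    using e lambda_mult(2)[OF m sS] by (simp add: cf_add low_def)
  moreover have "v * u \<in> A \<inter> S" "regular_in S (v * u)"
    using v u BS BA A_mult S_mult regular_in_mult[OF S_ring] by auto
  ultimately show ?thesis using sL by blast
qed

end

section \<open>Uniform and essential left ideals of a special subextension\<close>

text \<open>Principal left ideals reduce uniformity to pairs of elements; in this elementwise form
  it is proved and applied below.\<close>

lemma uniform_common_multiple:
  assumes "is_subring A" "uniform_left_ideal A I" "f \<in> I" "g \<in> I" "f \<noteq> 0" "g \<noteq> 0"
  shows "\<exists>a\<in>A. \<exists>b\<in>A. a * f = b * g \<and> a * f \<noteq> 0"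
proof -
  have I: "left_ideal A I" using assms(2) by (simp add: uniform_left_ideal_def)
  have *: "left_ideal A {a * h |a. a \<in> A}" "{a * h |a. a \<in> A} \<subseteq> I" "{a * h |a. a \<in> A} \<noteq> {0}"
    if h: "h \<in> I" "h \<noteq> 0" for h
  proof -
    have hA: "h \<in> A" using I h(1) unfolding left_ideal_def by blast
    show "left_ideal A {a * h |a. a \<in> A}" by (rule left_ideal_principal[OF assms(1) hA])
    show "{a * h |a. a \<in> A} \<subseteq> I" using I h(1) unfolding left_ideal_def by blast
    have "1 * h \<in> {a * h |a. a \<in> A}" using is_subringD(1)[OF assms(1)] by blast
    then show "{a * h |a. a \<in> A} \<noteq> {0}" using h(2) by auto
  qed
  have "{a * f |a. a \<in> A} \<inter> {a * g |a. a \<in> A} \<noteq> {0}"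
    using assms(2) *[OF assms(3,5)] *[OF assms(4,6)] unfolding uniform_left_ideal_def by blast
  moreover have "0 \<in> {a * f |a. a \<in> A} \<inter> {a * g |a. a \<in> A}"
    using *(1)[OF assms(3,5)] *(1)[OF assms(4,6)] unfolding left_ideal_def by blast
  ultimately obtain z where "z \<noteq> 0" "z \<in> {a * f |a. a \<in> A}" "z \<in> {a * g |a. a \<in> A}" by blast
  then obtain a b where "a \<in> A" "b \<in> A" "z = a * f" "z = b * g" by blast
  with \<open>z \<noteq> 0\<close> show ?thesis by (intro bexI[of _ a] bexI[of _ b]) auto
qed

lemma uniform_left_idealI:
  assumes "left_ideal A I" "I \<noteq> {0}"
    and "\<And>f g. f \<in> I \<Longrightarrow> g \<in> I \<Longrightarrow> f \<noteq> 0 \<Longrightarrow> g \<noteq> 0 \<Longrightarrow> \<exists>a\<in>A. \<exists>b\<in>A. a * f = b * g \<and> a * f \<noteq> 0"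
  shows "uniform_left_ideal A I"
  unfolding uniform_left_ideal_def
proof (intro conjI allI impI assms(1,2))
  fix L1 L2
  assume L: "left_ideal A L1" "left_ideal A L2" "L1 \<subseteq> I" "L2 \<subseteq> I" "L1 \<noteq> {0}" "L2 \<noteq> {0}"
  have "0 \<in> L1" "0 \<in> L2" using L(1,2) by (auto simp: left_ideal_def)
  then obtain f g where fg: "f \<in> L1" "f \<noteq> 0" "g \<in> L2" "g \<noteq> 0" using L(5,6) by blast
  then obtain a b where ab: "a \<in> A" "b \<in> A" "a * f = b * g" "a * f \<noteq> 0"
    using assms(3)[of f g] L(3,4) by blast
  have "a * f \<in> L1" "b * g \<in> L2" using ab fg L(1,2) unfolding left_ideal_def by blast+
  with ab(3,4) show "L1 \<inter> L2 \<noteq> {0}" by auto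
qed

lemma essential_multiple:
  assumes "is_subring A" "essential_left_ideal A I" "f \<in> A" "f \<noteq> 0"
  shows "\<exists>a\<in>A. a * f \<in> I \<and> a * f \<noteq> 0"
proof -
  have J: "left_ideal A {a * f |a. a \<in> A}" by (rule left_ideal_principal[OF assms(1,3)])
  have "1 * f \<in> {a * f |a. a \<in> A}" using is_subringD(1)[OF assms(1)] by blast
  then have "{a * f |a. a \<in> A} \<noteq> {0}" using assms(4) by auto
  then have "I \<inter> {a * f |a. a \<in> A} \<noteq> {0}"
    using assms(2) J unfolding essential_left_ideal_def by blast
  moreover have "0 \<in> I \<inter> {a * f |a. a \<in> A}"
    using J assms(2) unfolding left_ideal_def essential_left_ideal_def by blast
  ultimately show ?thesis by blast
qed

lemma essential_left_idealI:
  assumes "left_ideal A I" and "\<And>f. f \<in> A \<Longrightarrow> f \<noteq> 0 \<Longrightarrow> \<exists>a\<in>A. a * f \<in> I \<and> a * f \<noteq> 0"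
  shows "essential_left_ideal A I"
  unfolding essential_left_ideal_def
proof (intro conjI allI impI assms(1))
  fix J assume J: "left_ideal A J" "J \<noteq> {0}"
  have "0 \<in> J" "J \<subseteq> A" using J(1) by (auto simp: left_ideal_def)
  then obtain f where f: "f \<in> J" "f \<noteq> 0" "f \<in> A" using J(2) by blast
  obtain a where a: "a \<in> A" "a * f \<in> I" "a * f \<noteq> 0" using assms(2)[OF f(3,2)] by blast
  have "a * f \<in> J" using a(1) f(1) J(1) unfolding left_ideal_def by blast
  with a show "I \<inter> J \<noteq> {0}" by auto
qed

context special_ext
begin

definition meets :: "'a \<Rightarrow> 'a \<Rightarrow> bool" where
  "meets f g \<longleftrightarrow> (\<exists>a\<in>A. \<exists>b\<in>A. a * f = b * g \<and> a * f \<noteq> 0)"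

lemma meets_sym: "meets f g \<Longrightarrow> meets g f"
  unfolding meets_def by metis

lemma meets_smult: "meets (a * f) g \<Longrightarrow> a \<in> A \<Longrightarrow> meets f g"
  unfolding meets_def using A_mult by (metis mult.assoc)

text \<open>Moving e past \<open>ups n * x ^ n\<close> turns it into \<open>am n e\<close>. Thus a
  relation between right coefficients in \<open>B n\<close> is realised by left multiplications in
  A.\<close>

lemma cf_twist:
  assumes n: "n \<in> DegA" and e: "e \<in> B n" and s: "s \<in> S" and u: "u \<in> S"
    and t: "cf (u * f) n = ups n * (\<alpha> ^^ n) s"
  shows "cf (am n e * u * f) n = ups n * (\<alpha> ^^ n) (e * s)"
proof -
  have S: "am n e \<in> S" "e \<in> S" using am_B[OF n e] e B_S[OF n] by blast+
  have "cf (am n e * u * f) n = am n e * (ups n * (\<alpha> ^^ n) s)"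
    unfolding mult.assoc cf_smult[OF S(1)] t ..
  also have "\<dots> = ups n * ((\<alpha> ^^ n) e * (\<alpha> ^^ n) s)"
    using am_comm[OF n e] by (metis mult.assoc)
  finally show ?thesis unfolding apow_mult[OF S(2) s] .
qed

lemma regular_cf:
  assumes "regular_in S u" "cf f n \<noteq> 0"
  shows "cf (u * f) n \<noteq> 0"
proof -
  have "cf (u * f) n = u * cf f n" using assms(1) by (intro cf_smult) (simp add: regular_in_def)
  then show ?thesis using assms cf_S[of f n] by (auto simp: regular_in_def)
qed

text \<open>The element of larger degree is g, and the induction hypothesis is applied to the
  original f and the difference h. The raised multiple F of f serves only to build W.\<close>

lemma uniform_step:
  assumes L: "L \<subseteq> R" and hyp: "uniform_left_ideal (B n) (sumprod (B n) L)"
    and f: "f \<in> sumprod A L" "shadow f m c" and g: "g \<in> sumprod A L" "shadow g n c'" and mn: "m \<le> n"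
    and IH: "\<And>h. h \<in> sumprod A L \<Longrightarrow> h \<noteq> 0 \<Longrightarrow> h \<in> low n \<Longrightarrow> meets f h"
  shows "meets f g"
proof (rule ccontr)
  assume disj: "\<not> meets f g"
  have LS: "L \<subseteq> S" and LA: "L \<subseteq> A" using L R_S R_A by blast+
  have I: "left_ideal A (sumprod A L)" by (rule left_ideal_sumprod[OF A_ring LA])
  have A: "f \<in> A" "g \<in> A" using I f(1) g(1) unfolding left_ideal_def by blast+
  have tf: "topfaithful f m" "topfaithful g n" using f(2) g(2) unfolding shadow_def by blast+
  have low: "f \<in> low (Suc m)" "g \<in> low (Suc n)" using tf unfolding topfaithful_def by blast+
  have m: "m \<in> DegA" using mem_DegA[OF A(1) low(1)] shadow_nonzero[OF f(2)] by blast
  have n: "n \<in> DegA" using mem_DegA[OF A(2) low(2)] shadow_nonzero[OF g(2)] by blast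
  \<comment> \<open>Degrees in A are multiples of d, hence so is n - m, and f can be raised to
    degree exactly n.\<close>
  obtain k1 k2 where "m = d * k1" "n = d * k2" using m n unfolding Deg_multiples by blast
  then have "n = m + d * (k2 - k1)" using mn by (simp add: diff_mult_distrib2)
  then obtain G c2 where G: "G \<in> A" "shadow (G * f) n c2" using shadow_raise_mult[OF f(2), of "k2 - k1"] by auto
  define F where "F = G * f"
  have F: "F \<in> sumprod A L" unfolding F_def by (rule sumprod_mult[OF A_ring G(1) f(1)])
  have tF: "topfaithful F n" using G(2) unfolding F_def shadow_def by blast
  have lowF: "F \<in> low (Suc n)" using tF unfolding topfaithful_def by blast
  obtain u1 s1 where u1: "u1 \<in> A \<inter> S" "regular_in S u1" "s1 \<in> sumprod (B n) L" "cf (u1 * F) n = ups n * (\<alpha> ^^ n) s1"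
    using sumprod_top[OF F LS lowF n] by blast
  obtain u2 s2 where u2: "u2 \<in> A \<inter> S" "regular_in S u2" "s2 \<in> sumprod (B n) L" "cf (u2 * g) n = ups n * (\<alpha> ^^ n) s2"
    using sumprod_top[OF g(1) LS low(2) n] by blast
  have nz: "s1 \<noteq> 0" "s2 \<noteq> 0"
    using regular_cf[OF u1(2), of F n] shadow_nonzero[OF G(2)] u1(4)
      regular_cf[OF u2(2), of g n] shadow_nonzero[OF g(2)] u2(4) by (auto simp: F_def)
  \<comment> \<open>Uniformity of \<open>B n\<close> L enters here. The twists of e1 and e2 then
    give V and W the same leading coefficient.\<close>
  obtain e1 e2 where e: "e1 \<in> B n" "e2 \<in> B n" "e1 * s1 = e2 * s2" "e1 * s1 \<noteq> 0"
    using uniform_common_multiple[OF B_ring[OF n] hyp u1(3) u2(3) nz] by blast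
  have "sumprod (B n) L \<subseteq> B n"
    using left_ideal_sumprod[OF B_ring[OF n], of L] L R_B[OF n] unfolding left_ideal_def by blast
  then have S: "s1 \<in> S" "s2 \<in> S" "e1 \<in> S" using u1(3) u2(3) e(1) B_S[OF n] by blast+
  define V where "V = am n e2 * u2 * g"
  define W where "W = am n e1 * u1 * F"
  have amA: "am n e1 * u1 \<in> A" "am n e2 * u2 \<in> A"
    using am_B[OF n] e(1,2) B_A[OF n] u1(1) u2(1) A_mult by blast+
  have amS: "am n e1 * u1 \<in> S" "am n e2 * u2 \<in> S"
    using am_B[OF n] e(1,2) B_S[OF n] u1(1) u2(1) S_mult by blast+
  have cW: "cf W n = ups n * (\<alpha> ^^ n) (e1 * s1)" unfolding W_def
    by (rule cf_twist[OF n e(1) S(1) _ u1(4)]) (use u1(1) in blast)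
  have cV: "cf V n = ups n * (\<alpha> ^^ n) (e2 * s2)" unfolding V_def
    by (rule cf_twist[OF n e(2) S(2) _ u2(4)]) (use u2(1) in blast)
  have eq: "cf V n = cf W n" using cV cW e(3) by simp
  have nzW: "cf W n \<noteq> 0" using ups_cancel[OF n S_mult[OF S(3,1)]] cW e(4) by auto
  have tV: "topfaithful V n" unfolding V_def by (rule topfaithful_smult[OF tf(2) amS(2)])
  have tW: "topfaithful W n" unfolding W_def by (rule topfaithful_smult[OF tF amS(1)])
  have VW: "V \<in> sumprod A L" "W \<in> sumprod A L"
    unfolding V_def W_def using sumprod_mult[OF A_ring] amA F g(1) by blast+
  have Wf: "W = am n e1 * u1 * G * f" by (simp add: W_def F_def mult.assoc)
  have WA: "am n e1 * u1 * G \<in> A" using A_mult amA(1) G(1) by blast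
  define h where "h = V - W"
  have "V - W \<in> low (Suc n)" using tV tW low_diff unfolding topfaithful_def by blast
  then have hlow: "h \<in> low n" unfolding h_def low_Suc_iff[of _ n] cf_diff using eq by simp
  have "V - W = V + (0 - 1) * W" by simp
  moreover have "(0 - 1) * W \<in> sumprod A L"
    using sumprod_mult[OF A_ring _ VW(2)] A_diff is_subringD(1,5)[OF A_ring] by blast
  ultimately have hL: "h \<in> sumprod A L" unfolding h_def using sumprod_add[OF VW(1)] by metis
  \<comment> \<open>If V = W, this element would itself be a non-zero common multiple of f and
    g.\<close>
  have "h \<noteq> 0"
  proof
    assume "h = 0"
    then have "am n e1 * u1 * G * f = am n e2 * u2 * g" using Wf V_def h_def by simp
    moreover have "am n e1 * u1 * G * f \<noteq> 0" using nzW Wf by auto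
    ultimately show False using disj WA amA(2) unfolding meets_def by blast
  qed
  from IH[OF hL this hlow] obtain a q where aq: "a \<in> A" "q \<in> A" "a * f = q * h" "a * f \<noteq> 0"
    unfolding meets_def by blast
  \<comment> \<open>Moving q * W to the side of f turns a * f = q * h into an equality between a
    multiple of f and q * V, a multiple of g. By assumption this common multiple is 0.\<close>
  have "(a + q * (am n e1 * u1 * G)) * f = (q * (am n e2 * u2)) * g"
    using aq(3) Wf by (simp add: h_def V_def algebra_simps)
  moreover have "a + q * (am n e1 * u1 * G) \<in> A" "q * (am n e2 * u2) \<in> A"
    using aq A_mult WA amA is_subringD(2)[OF A_ring] by blast+
  ultimately have "(q * (am n e2 * u2)) * g = 0" using disj unfolding meets_def by metis
  then have "q * V = 0" by (simp add: V_def mult.assoc)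
  then have "q * W = 0" using topfaithful_annihilator[OF tV tW, of q] eq by simp
  with \<open>q * V = 0\<close> have "q * h = 0" by (simp add: h_def right_diff_distrib)
  with aq show False by simp
qed

text \<open>Induction on the sum of the degree bounds. First f and g are replaced by multiples with
  shadows, whose degrees are no larger; then the one of larger degree takes the role of g in
  \<open>uniform_step\<close>, and the difference there has strictly smaller degree.\<close>

lemma meets_sumprod:
  assumes L: "L \<subseteq> R" and hyp: "\<And>n. n \<in> DegA \<Longrightarrow> uniform_left_ideal (B n) (sumprod (B n) L)"
    and f: "f \<in> sumprod A L" "f \<noteq> 0" and g: "g \<in> sumprod A L" "g \<noteq> 0"
  shows "meets f g"
proof -
  have LA: "L \<subseteq> A" using L R_A by blast
  have I: "left_ideal A (sumprod A L)" by (rule left_ideal_sumprod[OF A_ring LA])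
  have main: "f \<in> sumprod A L \<Longrightarrow> f \<noteq> 0 \<Longrightarrow> g \<in> sumprod A L \<Longrightarrow> g \<noteq> 0 \<Longrightarrow>
      f \<in> low (Suc m) \<Longrightarrow> g \<in> low (Suc n) \<Longrightarrow> m + n = N \<Longrightarrow> meets f g" for f g m n N
  proof (induction N arbitrary: f g m n rule: less_induct)
    case (less N)
    obtain r1 m' c1 where r1: "r1 \<in> R" "m' \<le> m" "shadow (r1 * f) m' c1"
      using shadow_exists[OF less.prems(2,5)] by blast
    obtain r2 n' c2 where r2: "r2 \<in> R" "n' \<le> n" "shadow (r2 * g) n' c2"
      using shadow_exists[OF less.prems(4,6)] by blast
    let ?f = "r1 * f" and ?g = "r2 * g"
    have L: "?f \<in> sumprod A L" "?g \<in> sumprod A L"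
      using sumprod_mult[OF A_ring] R_A r1(1) r2(1) less.prems(1,3) by blast+
    then have A: "?f \<in> A" "?g \<in> A" using I unfolding left_ideal_def by blast+
    have low: "?f \<in> low (Suc m')" "?g \<in> low (Suc n')"
      using r1(3) r2(3) unfolding shadow_def topfaithful_def by blast+
    have nz: "?f \<noteq> 0" "?g \<noteq> 0" "cf ?f m' \<noteq> 0" "cf ?g n' \<noteq> 0"
      using shadow_nonzero[OF r1(3)] shadow_nonzero[OF r2(3)] by blast+
    have deg: "m' \<in> DegA" "n' \<in> DegA" using mem_DegA A low nz(3,4) by blast+
    \<comment> \<open>The induction takes bounds of the form \<open>Suc k\<close>. A non-zero
      element of \<open>low l\<close> has such a bound with k < l.\<close>
    have small: "\<exists>k. h \<in> low (Suc k) \<and> k < l" if h: "h \<noteq> 0" "h \<in> low l" for h l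
    proof -
      obtain k where k: "h \<in> low (Suc k)" "cf h k \<noteq> 0" using degree_exists[OF h(1)] .
      have "k < l" using k(2) h(2) unfolding low_def mem_Collect_eq by (meson not_less)
      with k(1) show ?thesis by blast
    qed
    have "meets ?f ?g"
    proof (cases "m' \<le> n'")
      case True
      show ?thesis
      proof (rule uniform_step[OF assms(1) hyp[OF deg(2)] L(1) r1(3) L(2) r2(3) True])
        fix h assume h: "h \<in> sumprod A L" "h \<noteq> 0" "h \<in> low n'"
        obtain k where k: "h \<in> low (Suc k)" "k < n'" using small[OF h(2,3)] by blast
        show "meets ?f h"
          by (rule less.IH[OF _ L(1) nz(1) h(1,2) low(1) k(1) refl]) (use k r1(2) r2(2) less.prems(7) in linarith)
      qed
    next
      case False
      then have le: "n' \<le> m'" by simp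
      have "meets ?g ?f"
      proof (rule uniform_step[OF assms(1) hyp[OF deg(1)] L(2) r2(3) L(1) r1(3) le])
        fix h assume h: "h \<in> sumprod A L" "h \<noteq> 0" "h \<in> low m'"
        obtain k where k: "h \<in> low (Suc k)" "k < m'" using small[OF h(2,3)] by blast
        show "meets ?g h"
          by (rule less.IH[OF _ L(2) nz(2) h(1,2) low(2) k(1) refl]) (use k r1(2) r2(2) less.prems(7) in linarith)
      qed
      then show ?thesis by (rule meets_sym)
    qed
    then show ?case using meets_smult meets_sym R_A r1(1) r2(1) by blast
  qed
  obtain m where "f \<in> low (Suc m)" using degree_exists[OF f(2)] .
  moreover obtain n where "g \<in> low (Suc n)" using degree_exists[OF g(2)] .
  ultimately show ?thesis using main[OF f g _ _ refl] by blast
qed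

text \<open>As in the uniform case, but the second partner W is manufactured: essentiality of
  \<open>B m\<close> L applied to the leading coefficient of a multiple of f gives s in L's
  extension to \<open>B m\<close>, and s is raised to the degree of g inside A L.\<close>

lemma essential_sumprod:
  assumes L: "L \<subseteq> R" and hyp: "\<And>n. n \<in> DegA \<Longrightarrow> essential_left_ideal (B n) (sumprod (B n) L)"
    and f: "f \<in> A" "f \<noteq> 0"
  shows "\<exists>a\<in>A. a * f \<in> sumprod A L \<and> a * f \<noteq> 0"
proof -
  have LA: "L \<subseteq> A" using L R_A by blast
  have I: "left_ideal A (sumprod A L)" by (rule left_ideal_sumprod[OF A_ring LA])
  have main: "f \<in> A \<Longrightarrow> f \<noteq> 0 \<Longrightarrow> f \<in> low N \<Longrightarrow> \<exists>a\<in>A. a * f \<in> sumprod A L \<and> a * f \<noteq> 0" for f N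
  proof (induction N arbitrary: f rule: less_induct)
    case (less N)
    show ?case
    proof (rule ccontr)
      assume disj: "\<not> (\<exists>a\<in>A. a * f \<in> sumprod A L \<and> a * f \<noteq> 0)"
      obtain M where M: "f \<in> low (Suc M)" "cf f M \<noteq> 0" using degree_exists[OF less.prems(2)] .
      have "M < N" using M(2) less.prems(3) unfolding low_def mem_Collect_eq by (meson not_less)
      obtain r m c where r: "r \<in> R" "m \<le> M" "shadow (r * f) m c" using shadow_exists[OF less.prems(2) M(1)] by blast
      define g where "g = r * f"
      have gA: "g \<in> A" unfolding g_def using A_mult R_A r(1) less.prems(1) by blast
      have tg: "topfaithful g m" using r(3) unfolding g_def shadow_def by blast
      then have lowg: "g \<in> low (Suc m)" unfolding topfaithful_def by blast
      have cg: "cf g m \<noteq> 0" using shadow_nonzero[OF r(3)] unfolding g_def by blast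
      have m: "m \<in> DegA" using mem_DegA[OF gA lowg cg] .
      have disjg: "a * g = 0" if "a \<in> A" "a * g \<in> sumprod A L" for a
        using disj A_mult[OF that(1) R_A[OF r(1)]] that(2) unfolding g_def by (metis mult.assoc)
      obtain u b0 where u: "u \<in> B m" "regular_in S u" "b0 \<in> B m" "u * cf g m = b0 * ups m"
        using B_multiple[OF m cf_S A_component[OF gA]] by blast
      obtain b where b: "b \<in> B m" "b0 = am m b" using am_surj[OF m u(3)] by blast
      note BS = subsetD[OF B_S[OF m]] and BA = subsetD[OF B_A[OF m]]
      note Bm = is_subringD(4)[OF B_ring[OF m]]
      have uS: "u \<in> S" and bS: "b \<in> S" using BS u(1) b(1) by blast+
      have cug: "cf (u * g) m = ups m * (\<alpha> ^^ m) b"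
        unfolding cf_smult[OF uS] u(4) b(2) am_comm[OF m b(1)] ..
      have bnz: "b \<noteq> 0" using regular_cf[OF u(2) cg] cug by auto
      obtain c1 where c1: "c1 \<in> B m" "c1 * b \<in> sumprod (B m) L" "c1 * b \<noteq> 0"
        using essential_multiple[OF B_ring[OF m] hyp[OF m] b(1) bnz] by blast
      have c1S: "c1 * b \<in> S" using BS Bm c1(1) b(1) by blast
      \<comment> \<open>As c1 * b is a constant, k must be 0, and the multiple of degree 0 can be
        raised to degree m.\<close>
      obtain r2 k c2 where r2: "r2 \<in> R" "k \<le> 0" "shadow (r2 * (c1 * b)) k c2"
        using shadow_exists[OF c1(3) low_const[OF c1S]] by blast
      define s where "s = r2 * c1 * b"
      have r2c1: "r2 * c1 \<in> B m" using Bm c1(1) r2(1) R_B[OF m] by blast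
      have shs: "shadow s 0 c2" using r2 by (simp add: s_def mult.assoc)
      have sS: "s \<in> S" unfolding s_def using BS Bm r2c1 b(1) by blast
      have "s = r2 * (c1 * b)" by (simp add: s_def mult.assoc)
      then have sL: "s \<in> sumprod (B m) L"
        using sumprod_mult[OF B_ring[OF m] _ c1(2)] r2(1) R_B[OF m] by blast
      have "sumprod (B m) L \<subseteq> sumprod A L" by (rule sumprod_mono) (use BA in auto)
      then have sAL: "s \<in> sumprod A L" using sL by blast
      obtain j where "m = d * j" using m unfolding Deg_multiples by blast
      then obtain G c3 where G: "G \<in> A" "shadow (G * s) m c3" using shadow_raise_mult[OF shs, of j] by auto
      have tG: "topfaithful (G * s) m" using G(2) unfolding shadow_def by blast
      then have lowG: "G * s \<in> low (Suc m)" unfolding topfaithful_def by blast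
      \<comment> \<open>Applying \<open>sumprod_top\<close> to {s} rather than to L keeps the
        coefficient of W a left multiple of s, hence of b, so that a multiple of g can match
        it.\<close>
      have Gs: "G * s \<in> sumprod A {s}" using sumprod_prodI[OF G(1)] by blast
      obtain u2 t where u2: "u2 \<in> A \<inter> S" "regular_in S u2" "t \<in> sumprod (B m) {s}"
        "cf (u2 * (G * s)) m = ups m * (\<alpha> ^^ m) t"
        using sumprod_top[OF Gs _ lowG m] sS by blast
      obtain b1 where b1: "b1 \<in> B m" "t = b1 * s"
      proof -
        obtain n :: nat and a z where "\<forall>i<n. a i \<in> B m \<and> z i \<in> {s}" "t = (\<Sum>i<n. a i * z i)"
          using u2(3) unfolding sumprod_def by blast
        then have "t = (\<Sum>i<n. a i) * s" "(\<Sum>i<n. a i) \<in> B m"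
          by (auto simp: sum_distrib_right intro!: is_subring_sum[OF B_ring[OF m]])
        with that show ?thesis by blast
      qed
      \<comment> \<open>With this e, t = e * b, and the twist of e applied to u * g has the leading
        coefficient of W.\<close>
      define e where "e = b1 * (r2 * c1)"
      have eB: "e \<in> B m" unfolding e_def using Bm b1(1) r2c1 by blast
      have te: "t = e * b" using b1(2) by (simp add: e_def s_def mult.assoc)
      define V where "V = am m e * u * g"
      define W where "W = u2 * (G * s)"
      have amA: "am m e * u \<in> A" and amS: "am m e * u \<in> S"
        using am_B[OF m eB] u(1) Bm BA BS by blast+
      have cV: "cf V m = ups m * (\<alpha> ^^ m) t" unfolding V_def te
        by (rule cf_twist[OF m eB bS uS cug])
      have eq: "cf V m = cf W m" using cV u2(4) by (simp add: W_def)
      have nzW: "cf W m \<noteq> 0" using regular_cf[OF u2(2)] shadow_nonzero[OF G(2)] by (simp add: W_def)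
      have tV: "topfaithful V m" unfolding V_def by (rule topfaithful_smult[OF tg amS])
      have tW: "topfaithful W m" unfolding W_def by (rule topfaithful_smult[OF tG]) (use u2(1) in blast)
      have WL: "W \<in> sumprod A L"
        unfolding W_def using sumprod_mult[OF A_ring] u2(1) G(1) sAL by blast
      define h where "h = V - W"
      have "V - W \<in> low (Suc m)" using tV tW low_diff unfolding topfaithful_def by blast
      then have hlow: "h \<in> low m" unfolding h_def low_Suc_iff[of _ m] cf_diff using eq by simp
      have VA: "V \<in> A" and WA: "W \<in> A" unfolding V_def using A_mult amA gA WL I unfolding left_ideal_def by blast+
      then have hA: "h \<in> A" unfolding h_def using A_diff by blast
      \<comment> \<open>Otherwise V = W would be a non-zero multiple of g in A L.\<close>
      have "h \<noteq> 0"
      proof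
        assume "h = 0"
        then have "V \<in> sumprod A L" using WL by (simp add: h_def)
        then have "V = 0" using disjg[OF amA] by (simp add: V_def)
        then show False using eq nzW by simp
      qed
      moreover have "m < N" using \<open>M < N\<close> r(2) by simp
      ultimately obtain q where q: "q \<in> A" "q * h \<in> sumprod A L" "q * h \<noteq> 0"
        using less.IH[OF _ hA _ hlow] by blast
      have "q * V = q * h + q * W" by (simp add: h_def right_diff_distrib)
      moreover have "q * W \<in> sumprod A L" by (rule sumprod_mult[OF A_ring q(1) WL])
      ultimately have "q * V \<in> sumprod A L" using sumprod_add[OF q(2)] by simp
      then have "q * V = 0" using disjg[of "q * (am m e * u)"] A_mult[OF q(1) amA] by (simp add: V_def mult.assoc)
      then have "q * W = 0" using topfaithful_annihilator[OF tV tW, of q] eq by simp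
      with \<open>q * V = 0\<close> q(3) show False by (simp add: h_def right_diff_distrib)
    qed
  qed
  obtain N where "f \<in> low N" using low_exists by blast
  then show ?thesis using main[OF f] by blast
qed

end

section \<open>Independent families and uniform dimension\<close>

definition independent_family :: "nat \<Rightarrow> (nat \<Rightarrow> 'a::ring_1 set) \<Rightarrow> bool" where
  "independent_family n F \<longleftrightarrow>
     (\<forall>y. (\<forall>i<n. y i \<in> F i) \<longrightarrow> (\<Sum>i<n. y i) = 0 \<longrightarrow> (\<forall>i<n. y i = 0))"

definition ssum :: "nat set \<Rightarrow> (nat \<Rightarrow> 'a::ring_1 set) \<Rightarrow> 'a set" where
  "ssum J F = {\<Sum>j\<in>J. z j | z. \<forall>j\<in>J. z j \<in> F j}"

lemma independent_familyD:
  assumes "independent_family n F" "\<And>i. i < n \<Longrightarrow> y i \<in> F i" "(\<Sum>i<n. y i) = 0" "i < n"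
  shows "y i = 0"
  using assms unfolding independent_family_def by blast

lemma left_ideal_uminus:
  assumes "is_subring A" "left_ideal A I" "y \<in> I" shows "- y \<in> I"
proof -
  have "(0 - 1) * y \<in> I"
    using assms is_subringD(1,5)[OF assms(1)] is_subringD(3)[OF assms(1), of 0 1]
    unfolding left_ideal_def by blast
  then show ?thesis by simp
qed

lemma ssumI: "(\<And>j. j \<in> J \<Longrightarrow> z j \<in> F j) \<Longrightarrow> (\<Sum>j\<in>J. z j) \<in> ssum J F"
  unfolding ssum_def by blast

lemma left_ideal_ssum:
  assumes "\<And>j. j \<in> J \<Longrightarrow> left_ideal A (F j)" "is_subring A"
  shows "left_ideal A (ssum J F)"
proof -
  have F: "F j \<subseteq> A" "0 \<in> F j" "\<And>a b. a \<in> F j \<Longrightarrow> b \<in> F j \<Longrightarrow> a + b \<in> F j"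
    "\<And>r a. r \<in> A \<Longrightarrow> a \<in> F j \<Longrightarrow> r * a \<in> F j" if "j \<in> J" for j
    using assms(1)[OF that] unfolding left_ideal_def by blast+
  show ?thesis unfolding left_ideal_def
  proof (intro conjI ballI subsetI)
    fix y assume "y \<in> ssum J F"
    then obtain z where "y = (\<Sum>j\<in>J. z j)" "\<forall>j\<in>J. z j \<in> F j" unfolding ssum_def by blast
    then show "y \<in> A" using F(1) by (auto intro!: is_subring_sum[OF assms(2)])
  next
    show "0 \<in> ssum J F" using ssumI[of J "\<lambda>_. 0" F] F(2) by simp
  next
    fix y y' assume "y \<in> ssum J F" "y' \<in> ssum J F"
    then obtain z z' where "y = (\<Sum>j\<in>J. z j)" "\<forall>j\<in>J. z j \<in> F j" "y' = (\<Sum>j\<in>J. z' j)" "\<forall>j\<in>J. z' j \<in> F j"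
      unfolding ssum_def by blast
    then show "y + y' \<in> ssum J F"
      using ssumI[of J "\<lambda>j. z j + z' j" F] F(3) by (simp add: sum.distrib)
  next
    fix r y assume "r \<in> A" "y \<in> ssum J F"
    then obtain z where "y = (\<Sum>j\<in>J. z j)" "\<forall>j\<in>J. z j \<in> F j" unfolding ssum_def by blast
    then show "r * y \<in> ssum J F"
      using ssumI[of J "\<lambda>j. r * z j" F] F(4) \<open>r \<in> A\<close> by (simp add: sum_distrib_left)
  qed
qed

lemma ssum_member:
  assumes "finite J" "i \<in> J" "y \<in> F i" "\<And>j. j \<in> J \<Longrightarrow> 0 \<in> F j"
  shows "y \<in> ssum J F"
proof -
  have "(\<Sum>j\<in>J. if j = i then y else 0) \<in> ssum J F"
    by (rule ssumI) (use assms in auto)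
  then show ?thesis using assms(1,2) by simp
qed

lemma sum_split_one:
  fixes y :: "nat \<Rightarrow> 'a::ring_1"
  assumes "i < n" shows "(\<Sum>j<n. y j) = y i + (\<Sum>j\<in>{..<n} - {i}. y j)"
  using assms by (simp add: sum.remove)

lemma independent_disjoint:
  assumes C: "is_subring C" and F: "\<And>j. j < n \<Longrightarrow> left_ideal C (F j)"
    and ind: "independent_family n F" and i: "i < n"
  shows "F i \<inter> ssum ({..<n} - {i}) F = {0}"
proof -
  have "y = 0" if y: "y \<in> F i" "y \<in> ssum ({..<n} - {i}) F" for y
  proof -
    obtain z where z: "y = (\<Sum>j\<in>{..<n} - {i}. z j)" "\<forall>j\<in>{..<n} - {i}. z j \<in> F j"
      using y(2) unfolding ssum_def by blast
    define w where "w j = (if j = i then - y else z j)" for j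
    have "\<forall>j<n. w j \<in> F j"
      using z(2) y(1) left_ideal_uminus[OF C F[OF i]] by (auto simp: w_def)
    moreover have "(\<Sum>j\<in>{..<n} - {i}. w j) = (\<Sum>j\<in>{..<n} - {i}. z j)"
      by (rule sum.cong) (auto simp: w_def)
    then have "(\<Sum>j<n. w j) = 0" unfolding sum_split_one[OF i] z(1)[symmetric] by (simp add: w_def)
    ultimately have "w i = 0" using ind i unfolding independent_family_def by blast
    then show "y = 0" by (simp add: w_def)
  qed
  moreover have "left_ideal C (ssum ({..<n} - {i}) F)" by (rule left_ideal_ssum[OF F C]) simp
  then have "0 \<in> F i" "0 \<in> ssum ({..<n} - {i}) F" using F[OF i] unfolding left_ideal_def by blast+
  ultimately show ?thesis by blast
qed

lemma independent_replace:
  assumes C: "is_subring C" and F: "\<And>j. j < n \<Longrightarrow> left_ideal C (F j)"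
    and ind: "independent_family n F" and i: "i < n" and V: "left_ideal C V"
    and disj: "V \<inter> ssum ({..<n} - {i}) F = {0}"
  shows "independent_family n (F(i := V))"
  unfolding independent_family_def
proof (intro allI impI)
  fix y k assume y: "\<forall>j<n. y j \<in> (F(i := V)) j" "(\<Sum>j<n. y j) = 0" and k: "k < n"
  have "(\<Sum>j\<in>{..<n} - {i}. y j) \<in> ssum ({..<n} - {i}) F" by (rule ssumI) (use y(1) in auto)
  moreover have "(\<Sum>j\<in>{..<n} - {i}. y j) = - y i"
    using y(2) unfolding sum_split_one[OF i] by (simp only: add_eq_0_iff)
  moreover have "y i \<in> V" using y(1) i by auto
  then have "- y i \<in> V" by (rule left_ideal_uminus[OF C V])
  ultimately have "- y i \<in> {0}" unfolding disj[symmetric] by simp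
  then have yi: "y i = 0" by simp
  define w where "w = y(i := 0)"
  have "\<forall>j<n. w j \<in> F j" using y(1) F[OF i] by (auto simp: w_def left_ideal_def)
  moreover have "w = y" using yi by (auto simp: w_def)
  ultimately show "y k = 0" using ind y(2) k unfolding independent_family_def by blast
qed

text \<open>The components are treated one at a time: if r * v i is non-zero, it has a common
  multiple in K with a non-zero element of V i in K. Earlier components stay in K because K is a
  left ideal.\<close>

lemma multiple_into_meeting_ideal:
  assumes C: "is_subring C" and V: "\<And>j. j < k \<Longrightarrow> uniform_left_ideal C (V j)"
    and ind: "independent_family k V" and K: "left_ideal C K"
    and meet: "\<And>j. j < k \<Longrightarrow> V j \<inter> K \<noteq> {0}"
    and v: "\<And>j. j < k \<Longrightarrow> v j \<in> V j" "(\<Sum>j<k. v j) \<noteq> 0"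
  shows "\<exists>r\<in>C. r * (\<Sum>j<k. v j) \<in> K \<and> r * (\<Sum>j<k. v j) \<noteq> 0"
proof -
  have VI: "left_ideal C (V j)" if "j < k" for j using V[OF that] by (simp add: uniform_left_ideal_def)
  have "\<exists>r\<in>C. r * (\<Sum>j<k. v j) \<noteq> 0 \<and> (\<forall>j<i. r * v j \<in> K)" if "i \<le> k" for i
    using that
  proof (induction i)
    case 0
    show ?case using v(2) is_subringD(1)[OF C] by (intro bexI[of _ 1]) auto
  next
    case (Suc i)
    then obtain r where r: "r \<in> C" "r * (\<Sum>j<k. v j) \<noteq> 0" "\<forall>j<i. r * v j \<in> K" by auto
    have i: "i < k" using Suc.prems by simp
    show ?case
    proof (cases "r * v i = 0")
      case True
      then have "\<forall>j<Suc i. r * v j \<in> K" using r(3) K by (auto simp: less_Suc_eq left_ideal_def)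
      with r show ?thesis by blast
    next
      case False
      have "0 \<in> V i \<inter> K" using VI[OF i] K by (auto simp: left_ideal_def)
      then obtain w where w: "w \<in> V i" "w \<in> K" "w \<noteq> 0" using meet[OF i] by blast
      have rv: "r * v j \<in> V j" if "j < k" for j
        using VI[OF that] v(1)[OF that] r(1) unfolding left_ideal_def by blast
      obtain a b where ab: "a \<in> C" "b \<in> C" "a * (r * v i) = b * w" "a * (r * v i) \<noteq> 0"
        using uniform_common_multiple[OF C V[OF i] rv[OF i] w(1) False w(3)] by blast
      have "a * r * v j \<in> K" if "j < Suc i" for j
      proof (cases "j = i")
        case True
        have "b * w \<in> K" using ab(2) w(2) K unfolding left_ideal_def by blast
        then show ?thesis using ab(3) True by (simp add: mult.assoc)
      next
        case False
        then have "r * v j \<in> K" using that r(3) by simp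
        then have "a * (r * v j) \<in> K" using ab(1) K unfolding left_ideal_def by blast
        then show ?thesis by (simp add: mult.assoc)
      qed
      \<comment> \<open>By independence a vanishing sum would make its i-th component vanish, but
        that component was kept non-zero.\<close>
      moreover have "a * r * (\<Sum>j<k. v j) \<noteq> 0"
      proof
        assume "a * r * (\<Sum>j<k. v j) = 0"
        then have "(\<Sum>j<k. a * (r * v j)) = 0" by (simp add: sum_distrib_left mult.assoc)
        moreover have "a * (r * v j) \<in> V j" if "j < k" for j
          using rv[OF that] VI[OF that] ab(1) unfolding left_ideal_def by blast
        ultimately have "a * (r * v i) = 0"
          using independent_familyD[OF ind, of "\<lambda>j. a * (r * v j)" i] i by simp
        with ab(4) show False by blast
      qed
      moreover have "a * r \<in> C" using is_subringD(4)[OF C ab(1) r(1)] .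
      ultimately show ?thesis by blast
    qed
  qed
  from this[of k] obtain r where r: "r \<in> C" "r * (\<Sum>j<k. v j) \<noteq> 0" "\<forall>j<k. r * v j \<in> K" by auto
  have "r * (\<Sum>j<k. v j) \<in> K" unfolding sum_distrib_left
    by (rule left_ideal_sum[OF K]) (use r(3) in auto)
  with r show ?thesis by blast
qed

text \<open>Steinitz exchange: the members of the family \<open>I\<close> are replaced one at a time by members of \<open>V\<close>.\<close>
lemma independent_family_bound:
  assumes C: "is_subring C" and V: "\<And>j. j < k \<Longrightarrow> uniform_left_ideal C (V j)"
    and indV: "independent_family k V"
    and ess: "\<And>f. f \<in> C \<Longrightarrow> f \<noteq> 0 \<Longrightarrow> \<exists>a\<in>C. a * f \<in> ssum {..<k} V \<and> a * f \<noteq> 0"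
    and I: "\<And>i. i < n \<Longrightarrow> left_ideal C (I i) \<and> I i \<noteq> {0}" and indI: "independent_family n I"
  shows "n \<le> k"
proof -
  have VI: "left_ideal C (V j)" "V j \<noteq> {0}" if "j < k" for j
    using V[OF that] by (auto simp: uniform_left_ideal_def)
  have "\<exists>p. inj_on p {..<m} \<and> p ` {..<m} \<subseteq> {..<k} \<and>
      independent_family n (\<lambda>i. if i < m then V (p i) else I i)" if "m \<le> n" for m
    using that
  proof (induction m)
    case 0
    show ?case using indI by simp
  next
    case (Suc m)
    then obtain p where p: "inj_on p {..<m}" "p ` {..<m} \<subseteq> {..<k}"
      "independent_family n (\<lambda>i. if i < m then V (p i) else I i)" by auto
    have m: "m < n" using Suc.prems by simp
    define F where "F = (\<lambda>i. if i < m then V (p i) else I i)"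
    have F: "left_ideal C (F j)" "F j \<noteq> {0}" if "j < n" for j
      using VI[of "p j"] I[OF that] p(2) by (auto simp: F_def)
    have indF: "independent_family n F" using p(3) by (simp add: F_def)
    define K where "K = ssum ({..<n} - {m}) F"
    have K: "left_ideal C K" unfolding K_def by (rule left_ideal_ssum[OF F(1) C]) simp
    have disj: "F m \<inter> K = {0}" unfolding K_def by (rule independent_disjoint[OF C F(1) indF m])
    \<comment> \<open>If every V j met K, a non-zero element of F m would have a non-zero multiple
      first in the sum of the V j and then in K, although F m meets K trivially.\<close>
    have "\<exists>j<k. V j \<inter> K = {0}"
    proof (rule ccontr)
      assume "\<not> ?thesis"
      then have meet: "\<And>j. j < k \<Longrightarrow> V j \<inter> K \<noteq> {0}" by blast
      have "0 \<in> F m" "F m \<subseteq> C" using F(1)[OF m] by (auto simp: left_ideal_def)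
      then obtain f where f: "f \<in> F m" "f \<in> C" "f \<noteq> 0" using F(2)[OF m] by blast
      obtain a where a: "a \<in> C" "a * f \<in> ssum {..<k} V" "a * f \<noteq> 0" using ess[OF f(2,3)] by blast
      obtain v where v: "a * f = (\<Sum>j<k. v j)" "\<forall>j\<in>{..<k}. v j \<in> V j" using a(2) unfolding ssum_def by blast
      have "\<exists>r\<in>C. r * (\<Sum>j<k. v j) \<in> K \<and> r * (\<Sum>j<k. v j) \<noteq> 0"
        by (rule multiple_into_meeting_ideal[OF C V indV K meet]) (use v a(3) in simp_all)
      then obtain r where r: "r \<in> C" "r * (a * f) \<in> K" "r * (a * f) \<noteq> 0" unfolding v(1) by blast
      have "r * (a * f) \<in> F m" using F(1)[OF m] f(1) a(1) r(1) unfolding left_ideal_def by blast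
      with r disj show False by blast
    qed
    then obtain j where j: "j < k" "V j \<inter> K = {0}" by blast
    \<comment> \<open>The members of V already inserted lie in K, so the new index differs from
      theirs; at m = n the indices embed n into k.\<close>
    have notin: "j \<notin> p ` {..<m}"
    proof
      assume "j \<in> p ` {..<m}"
      then obtain i where i: "i < m" "j = p i" by auto
      have "F i \<subseteq> K" unfolding K_def
        using ssum_member[of "{..<n} - {m}" i _ F] i(1) m F(1) by (auto simp: left_ideal_def)
      then have "V j \<subseteq> K" using i by (simp add: F_def)
      with j VI(2)[OF j(1)] show False by blast
    qed
    have ind': "independent_family n (F(m := V j))"
      by (rule independent_replace[OF C F(1) indF m VI(1)[OF j(1)]]) (use j(2) in \<open>simp_all add: K_def\<close>)
    define p' where "p' = p(m := j)"
    have "F(m := V j) = (\<lambda>i. if i < Suc m then V (p' i) else I i)"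
      by (auto simp: F_def p'_def fun_eq_iff less_Suc_eq)
    moreover have "inj_on p' {..<Suc m}"
      using p(1) notin by (auto simp: p'_def inj_on_def less_Suc_eq)
    moreover have "p' ` {..<Suc m} \<subseteq> {..<k}"
      using p(2) j(1) by (auto simp: p'_def less_Suc_eq image_subset_iff)
    ultimately show ?case using ind' by metis
  qed
  from this[of n] obtain p where "inj_on p {..<n}" "p ` {..<n} \<subseteq> {..<k}" by auto
  from card_inj_on_le[OF this] show ?thesis by simp
qed

section \<open>Uniform dimension as a supremum of lengths\<close>

lemma udim_alt:
  "udim A = Sup {enat n | n. \<exists>Ls. (\<forall>i<n. left_ideal A (Ls i) \<and> Ls i \<noteq> {0}) \<and> independent_family n Ls}"
  unfolding udim_def independent_family_def ..

lemma udim_ge: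
  assumes "\<And>i. i < n \<Longrightarrow> left_ideal A (Ls i) \<and> Ls i \<noteq> {0}" "independent_family n Ls"
  shows "enat n \<le> udim A"
  unfolding udim_alt
proof (rule Sup_upper, rule CollectI, intro exI conjI)
  show "\<forall>i<n. left_ideal A (Ls i) \<and> Ls i \<noteq> {0}" using assms(1) by blast
qed (use assms(2) in simp_all)

text \<open>A finite supremum of a non-empty set in \<open>enat\<close> is a maximum; the empty
  family shows that the set of lengths is non-empty.\<close>

lemma udim_attained:
  assumes "udim A = enat k"
  shows "\<exists>Ls. (\<forall>i<k. left_ideal A (Ls i) \<and> Ls i \<noteq> {0}) \<and> independent_family k Ls"
proof -
  define X where "X = {enat n | n. \<exists>Ls. (\<forall>i<n. left_ideal A (Ls i) \<and> Ls i \<noteq> {0}) \<and> independent_family n Ls}"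
  have "\<exists>Ls. (\<forall>i<0. left_ideal A (Ls i) \<and> Ls i \<noteq> {0}) \<and> independent_family 0 Ls"
    by (simp add: independent_family_def)
  then have "X \<noteq> {}" unfolding X_def by blast
  moreover have "Sup X = enat k" using assms by (simp add: udim_alt X_def)
  ultimately have "finite X" "Max X = enat k" unfolding Sup_enat_def by (auto split: if_splits)
  then have "enat k \<in> X" using Max_in[OF _ \<open>X \<noteq> {}\<close>] by simp
  then show ?thesis unfolding X_def by auto
qed

lemma independent_subfamily:
  assumes "independent_family n F" "\<And>i. i < n \<Longrightarrow> G i \<subseteq> F i"
  shows "independent_family n G"
  unfolding independent_family_def
proof (intro allI impI)
  fix y i assume "\<forall>i<n. y i \<in> G i" "(\<Sum>i<n. y i) = 0" "i < n"
  then show "y i = 0" using independent_familyD[OF assms(1), of y i] assms(2) by blast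
qed

text \<open>Uniform left ideals are chosen inside an independent family of maximal length. If some
  non-zero f had no non-zero multiple in their sum, R f could be appended, giving an independent
  family of length k + 1.\<close>

lemma essential_uniform_sum:
  assumes R: "is_subring R" and enough: "enough_uniform R" and k: "udim R = enat k"
  shows "\<exists>U. (\<forall>i<k. uniform_left_ideal R (U i)) \<and> independent_family k U \<and>
      essential_left_ideal R (ssum {..<k} U)"
proof -
  obtain Ls where Ls: "\<forall>i<k. left_ideal R (Ls i) \<and> Ls i \<noteq> {0}" "independent_family k Ls"
    using udim_attained[OF k] by blast
  have "\<forall>i. \<exists>V. i < k \<longrightarrow> V \<subseteq> Ls i \<and> uniform_left_ideal R V"
  proof
    fix i
    show "\<exists>V. i < k \<longrightarrow> V \<subseteq> Ls i \<and> uniform_left_ideal R V"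
    proof (cases "i < k")
      case True
      with Ls(1) have "left_ideal R (Ls i)" "Ls i \<noteq> {0}" by simp_all
      with enough show ?thesis unfolding enough_uniform_def by blast
    qed simp
  qed
  from choice[OF this]
  obtain U where "\<forall>i. i < k \<longrightarrow> U i \<subseteq> Ls i \<and> uniform_left_ideal R (U i)" ..
  then have U: "U i \<subseteq> Ls i" "uniform_left_ideal R (U i)" if "i < k" for i using that by simp_all
  have ind: "independent_family k U" by (rule independent_subfamily[OF Ls(2) U(1)])
  have UI: "left_ideal R (U i)" "U i \<noteq> {0}" if "i < k" for i
    using U(2)[OF that] by (auto simp: uniform_left_ideal_def)
  have E: "left_ideal R (ssum {..<k} U)" by (rule left_ideal_ssum[OF UI(1) R]) simp
  have "\<exists>a\<in>R. a * f \<in> ssum {..<k} U \<and> a * f \<noteq> 0" if f: "f \<in> R" "f \<noteq> 0" for f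
  proof (rule ccontr)
    assume c: "\<not> ?thesis"
    define F where "F i = (if i < k then U i else {a * f |a. a \<in> R})" for i
    have P: "left_ideal R {a * f |a. a \<in> R}" by (rule left_ideal_principal[OF R f(1)])
    have "1 * f \<in> {a * f |a. a \<in> R}" using is_subringD(1)[OF R] by blast
    then have nz: "{a * f |a. a \<in> R} \<noteq> {0}" using f(2) by auto
    have "independent_family (Suc k) F" unfolding independent_family_def
    proof (intro allI impI)
      fix y i assume y: "\<forall>j<Suc k. y j \<in> F j" "(\<Sum>j<Suc k. y j) = 0" and i: "i < Suc k"
      have yU: "\<forall>j<k. y j \<in> U j" using y(1) by (auto simp: F_def less_Suc_eq)
      have "(\<Sum>j<k. y j) \<in> ssum {..<k} U" by (rule ssumI) (use yU in auto)
      then have "- (\<Sum>j<k. y j) \<in> ssum {..<k} U" by (rule left_ideal_uminus[OF R E])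
      moreover have yk: "y k = - (\<Sum>j<k. y j)" using y(2) by (simp add: eq_neg_iff_add_eq_0 add.commute)
      moreover have "y k \<in> F k" using y(1) by simp
      then obtain a where "a \<in> R" "y k = a * f" by (auto simp: F_def)
      ultimately have "y k = 0" using c by (metis (no_types))
      then have "(\<Sum>j<k. y j) = 0" using yk by simp
      then have "y j = 0" if "j < k" for j using independent_familyD[OF ind, of y j] yU that by blast
      then show "y i = 0" using \<open>y k = 0\<close> i by (auto simp: less_Suc_eq)
    qed
    then have "enat (Suc k) \<le> udim R"
      by (rule udim_ge[rotated]) (use UI P nz in \<open>simp add: F_def\<close>)
    then show False using k by simp
  qed
  then have "essential_left_ideal R (ssum {..<k} U)" by (rule essential_left_idealI[OF E])
  with U(2) ind show ?thesis by blast
qed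

section \<open>Multipliers into a nicely essential subring\<close>

lemma nicely_essential_multiple:
  assumes "nicely_essential C A" "finite E" "E \<subseteq> A"
  shows "\<exists>b\<in>C. \<forall>y\<in>E. b * y \<in> C \<and> (y \<noteq> 0 \<longrightarrow> b * y \<noteq> 0)"
proof -
  have C: "is_subring C" using assms(1) unfolding nicely_essential_def by blast
  have "finite (E - {0})" "E - {0} \<subseteq> A - {0}" using assms(2,3) by auto
  then obtain b where b: "b \<in> C" "\<forall>y\<in>E - {0}. b * y \<noteq> 0 \<and> b * y \<in> C"
    using assms(1) unfolding nicely_essential_def by blast
  have "b * y \<in> C \<and> (y \<noteq> 0 \<longrightarrow> b * y \<noteq> 0)" if "y \<in> E" for y
    using b(2) that is_subringD(5)[OF C] by (cases "y = 0") auto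
  with b(1) show ?thesis by blast
qed

text \<open>The multiplier b is chosen for all coefficients occurring in the y j at once. Since it
  moves these coefficients into C, it moves y j into C L j, while keeping the non-zero elements of E
  non-zero.\<close>

lemma nicely_essential_sumprod:
  fixes L :: "nat \<Rightarrow> 'a::ring_1 set"
  assumes ne: "nicely_essential C A" and A: "is_subring A" and L: "\<And>j. j \<in> J \<Longrightarrow> L j \<subseteq> A"
    and J: "finite J" and y: "\<And>j. j \<in> J \<Longrightarrow> y j \<in> sumprod A (L j)" and E: "finite E" "E \<subseteq> A"
  shows "\<exists>b\<in>C. (\<forall>j\<in>J. b * y j \<in> C \<inter> sumprod C (L j)) \<and> (\<forall>e\<in>E. b * e \<in> C \<and> (e \<noteq> 0 \<longrightarrow> b * e \<noteq> 0))"
proof -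
  \<comment> \<open>A representation is packed into one tuple of length, coefficients and elements
    of L j, so that one choice over J provides all of them.\<close>
  define P where "P j t \<longleftrightarrow> (\<forall>i<fst t. fst (snd t) i \<in> A \<and> snd (snd t) i \<in> L j) \<and>
      y j = (\<Sum>i<fst t. fst (snd t) i * snd (snd t) i)"
    for j and t :: "nat \<times> (nat \<Rightarrow> 'a) \<times> (nat \<Rightarrow> 'a)"
  have "\<forall>j\<in>J. \<exists>t. P j t"
  proof
    fix j assume "j \<in> J"
    then obtain n :: nat and a l where "\<forall>i<n. a i \<in> A \<and> l i \<in> L j" "y j = (\<Sum>i<n. a i * l i)"
      using y[of j] unfolding sumprod_def by blast
    then have "P j (n, a, l)" by (simp add: P_def)
    then show "\<exists>t. P j t" ..
  qed
  from bchoice[OF this] obtain t where t: "\<forall>j\<in>J. P j (t j)" ..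
  define n where "n j = fst (t j)" for j
  define a where "a j = fst (snd (t j))" for j
  define l where "l j = snd (snd (t j))" for j
  have al: "(\<forall>i<n j. a j i \<in> A \<and> l j i \<in> L j) \<and> y j = (\<Sum>i<n j. a j i * l j i)" if "j \<in> J" for j
    using t that unfolding P_def n_def a_def l_def by blast
  have yA: "y j \<in> A" if "j \<in> J" for j
    using y[OF that] left_ideal_sumprod[OF A L[OF that]] unfolding left_ideal_def by blast
  define E' where "E' = E \<union> y ` J \<union> (\<Union>j\<in>J. a j ` {..<n j})"
  have "finite E'" unfolding E'_def using J E(1) by simp
  moreover have "E' \<subseteq> A" unfolding E'_def
  proof (intro Un_least E(2) UN_least image_subsetI)
    show "y j \<in> A" if "j \<in> J" for j using yA[OF that] .
    show "a j i \<in> A" if "j \<in> J" "i \<in> {..<n j}" for j i using al[OF that(1)] that(2) by blast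
  qed
  ultimately obtain b where b: "b \<in> C" "\<forall>e\<in>E'. b * e \<in> C \<and> (e \<noteq> 0 \<longrightarrow> b * e \<noteq> 0)"
    using nicely_essential_multiple[OF ne] by blast
  have "b * y j \<in> C \<inter> sumprod C (L j)" if j: "j \<in> J" for j
  proof
    show "b * y j \<in> C" using b(2) j by (auto simp: E'_def)
    have "b * y j = (\<Sum>i<n j. (b * a j i) * l j i)"
      using al[OF j] by (simp add: sum_distrib_left mult.assoc)
    also have "\<dots> \<in> sumprod C (L j)"
    proof (rule sumprod_sum, rule sumprod_prodI)
      fix i assume i: "i \<in> {..<n j}"
      then have "a j i \<in> E'" unfolding E'_def using j by blast
      then show "b * a j i \<in> C" using b(2) by blast
      show "l j i \<in> L j" using al[OF j] i by blast
    qed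
    finally show "b * y j \<in> sumprod C (L j)" .
  qed
  moreover have "\<forall>e\<in>E. b * e \<in> C \<and> (e \<noteq> 0 \<longrightarrow> b * e \<noteq> 0)" using b(2) by (auto simp: E'_def)
  ultimately show ?thesis using b(1) by blast
qed

lemma left_ideal_Int_sumprod:
  assumes "is_subring C" shows "left_ideal C (C \<inter> sumprod C L)"
  unfolding left_ideal_def
  by (auto intro: is_subringD[OF assms] sumprod_mult[OF assms] sumprod_zero sumprod_add)

section \<open>Nicely essential subrings\<close>

context ore
begin

lemma sum_pad_zeros:
  assumes "\<forall>k\<ge>M. s k = 0" "M \<le> N" shows "(\<Sum>k<M. x ^ k * s k) = (\<Sum>k<N. x ^ k * s k)"
  by (rule sum.mono_neutral_left) (use assms in auto)

text \<open>Since \<alpha> is onto, leading terms can be peeled off with coefficients on the right.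
  In this form right multiplication by elements of S acts coefficientwise.\<close>

lemma right_expansion: "\<exists>M s. (\<forall>k. s k \<in> S) \<and> (\<forall>k\<ge>M. s k = 0) \<and> a = (\<Sum>k<M. x ^ k * s k)"
proof -
  obtain N where "a \<in> low N" using low_exists by blast
  then show ?thesis
  proof (induction N arbitrary: a)
    case 0
    then show ?case using S_zero by (intro exI[of _ 0] exI[of _ "\<lambda>_. 0"]) (simp add: low_0)
  next
    case (Suc N)
    obtain t where t: "t \<in> S" "cf a N = (\<alpha> ^^ N) t" "a - x ^ N * t \<in> low N"
      using right_top[OF Suc.prems] .
    obtain M s where s: "\<forall>k. s k \<in> S" "\<forall>k\<ge>M. s k = 0" "a - x ^ N * t = (\<Sum>k<M. x ^ k * s k)"
      using Suc.IH[OF t(3)] by blast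
    define K where "K = max M (Suc N)"
    define s' where "s' k = s k + (if k = N then t else 0)" for k
    have "(\<Sum>k<K. x ^ k * s' k) = (\<Sum>k<K. x ^ k * s k) + (\<Sum>k<K. if k = N then x ^ N * t else 0)"
      unfolding sum.distrib[symmetric] by (rule sum.cong) (auto simp: s'_def distrib_left)
    also have "(\<Sum>k<K. if k = N then x ^ N * t else 0) = x ^ N * t" by (simp add: K_def less_max_iff_disj)
    also have "(\<Sum>k<K. x ^ k * s k) = a - x ^ N * t"
      using sum_pad_zeros[OF s(2), of K] s(3) by (simp add: K_def)
    finally have "a = (\<Sum>k<K. x ^ k * s' k)" by simp
    moreover have "\<forall>k. s' k \<in> S" using s(1) t(1) S_add S_zero by (simp add: s'_def)
    moreover have "\<forall>k\<ge>K. s' k = 0" using s(2) by (simp add: s'_def K_def)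
    ultimately show ?case by (intro exI[of _ K] exI[of _ s']) simp
  qed
qed

lemma right_expansion_unique:
  assumes "\<And>k. s k \<in> S" "(\<Sum>k<M. x ^ k * s k) = 0" "k < M"
  shows "s k = 0"
  using assms(2,3)
proof (induction M)
  case (Suc M)
  have xs: "x ^ k * s k \<in> low (Suc k)" "cf (x ^ k * s k) k = (\<alpha> ^^ k) (s k)" for k
    using xpow_mult_low[OF low_const[OF assms(1)[of k]], of k] assms(1)[of k] by (auto simp: cf_const)
  have "(\<Sum>k<M. x ^ k * s k) \<in> low M"
  proof (rule low_sum)
    show "x ^ k * s k \<in> low M" if "k \<in> {..<M}" for k
      using low_mono[OF _ xs(1)[of k], of M] that by simp
  qed
  then have "cf (\<Sum>k<M. x ^ k * s k) M = 0" by (simp add: low_def)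
  then have "cf (\<Sum>k<Suc M. x ^ k * s k) M = (\<alpha> ^^ M) (s M)" by (simp add: cf_add xs(2))
  then have "s M = 0" using Suc.prems(1) apow_eq_zero[OF assms(1)[of M]] by simp
  moreover have "s k = 0" if "k < M"
    by (rule Suc.IH[OF _ that]) (use Suc.prems(1) \<open>s M = 0\<close> in simp)
  ultimately show ?case using Suc.prems(2) less_Suc_eq by blast
qed simp

lemma sumprod_right_expansion:
  assumes "y \<in> sumprod UNIV L"
  shows "\<exists>M s. (\<forall>k. s k \<in> sumprod S L) \<and> (\<forall>k\<ge>M. s k = 0) \<and> y = (\<Sum>k<M. x ^ k * s k)"
proof -
  obtain n :: nat and a l where al: "\<forall>i<n. a i \<in> UNIV \<and> l i \<in> L" "y = (\<Sum>i<n. a i * l i)"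
    using assms unfolding sumprod_def by blast
  show ?thesis using al
  proof (induction n arbitrary: y)
    case 0
    then show ?case by (intro exI[of _ 0] exI[of _ "\<lambda>_. 0"]) (simp add: sumprod_zero)
  next
    case (Suc n)
    have "\<forall>i<n. a i \<in> UNIV \<and> l i \<in> L" using Suc.prems(1) by simp
    from Suc.IH[OF this refl] obtain M s where
      s: "\<forall>k. s k \<in> sumprod S L" "\<forall>k\<ge>M. s k = 0" "(\<Sum>i<n. a i * l i) = (\<Sum>k<M. x ^ k * s k)" by blast
    obtain N t where t: "\<forall>k. t k \<in> S" "\<forall>k\<ge>N. t k = 0" "a n = (\<Sum>k<N. x ^ k * t k)"
      using right_expansion[of "a n"] by blast
    define K where "K = max M N"
    have "a n * l n = (\<Sum>k<K. x ^ k * t k) * l n"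
      using sum_pad_zeros[OF t(2), of K] t(3) by (simp add: K_def)
    moreover have "(\<Sum>i<n. a i * l i) = (\<Sum>k<K. x ^ k * s k)"
      using sum_pad_zeros[OF s(2), of K] s(3) by (simp add: K_def)
    ultimately have "y = (\<Sum>k<K. x ^ k * (s k + t k * l n))"
      using Suc.prems(2) by (simp add: sum.distrib distrib_left sum_distrib_right mult.assoc)
    moreover have "l n \<in> L" using Suc.prems(1) by simp
    then have "\<forall>k. s k + t k * l n \<in> sumprod S L"
      using s(1) t(1) by (auto intro: sumprod_add sumprod_prodI)
    moreover have "\<forall>k\<ge>K. s k + t k * l n = 0" using s(2) t(2) by (simp add: K_def)
    ultimately show ?case by (intro exI[of _ K] exI[of _ "\<lambda>k. s k + t k * l n"]) simp
  qed
qed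

text \<open>Extending L to the Ore extension gives elements whose right coefficients lie in S L.
  Right coefficients are unique, so a common element has all of them in the intersection of S L and
  S L', which is 0.\<close>

lemma sumprod_UNIV_disjoint:
  assumes L: "L \<subseteq> S" "L' \<subseteq> S" and disj: "sumprod S L \<inter> sumprod S L' = {0}"
    and y: "y \<in> sumprod UNIV L" "y \<in> sumprod UNIV L'"
  shows "y = 0"
proof -
  obtain M s where s: "\<forall>k. s k \<in> sumprod S L" "\<forall>k\<ge>M. s k = 0" "y = (\<Sum>k<M. x ^ k * s k)"
    using sumprod_right_expansion[OF y(1)] by blast
  obtain N t where t: "\<forall>k. t k \<in> sumprod S L'" "\<forall>k\<ge>N. t k = 0" "y = (\<Sum>k<N. x ^ k * t k)"
    using sumprod_right_expansion[OF y(2)] by blast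
  define K where "K = max M N"
  have K: "y = (\<Sum>k<K. x ^ k * s k)" "y = (\<Sum>k<K. x ^ k * t k)"
    using sum_pad_zeros[OF s(2), of K] s(3) sum_pad_zeros[OF t(2), of K] t(3) by (simp_all add: K_def)
  have sub: "sumprod S L \<subseteq> S" "sumprod S L' \<subseteq> S"
    using left_ideal_sumprod[OF S_ring L(1)] left_ideal_sumprod[OF S_ring L(2)] unfolding left_ideal_def by blast+
  have inS: "s k - t k \<in> S" for k
    by (rule S_diff[OF subsetD[OF sub(1)] subsetD[OF sub(2)]]) (use s(1) t(1) in blast)+
  have zero: "(\<Sum>k<K. x ^ k * (s k - t k)) = 0"
    using K by (simp add: right_diff_distrib sum_subtractf)
  have "s k = 0" if "k < K" for k
  proof -
    have "s k - t k = 0" by (rule right_expansion_unique[of "\<lambda>k. s k - t k", OF inS zero that])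
    then have "s k = t k" by simp
    then have "s k \<in> sumprod S L'" using t(1) by metis
    with s(1) have "s k \<in> sumprod S L \<inter> sumprod S L'" by blast
    then show ?thesis using disj by simp
  qed
  then show ?thesis using K(1) by simp
qed

end

context special_ext
begin

text \<open>Hypothesis (ii) handles only two left ideals. It is applied to the i-th one and the sum
  of the others, for each i. Extending to the whole Ore extension covers every subring at
  once.\<close>

lemma independent_sumprod:
  assumes ii: "\<And>L L'. left_ideal R L \<Longrightarrow> left_ideal R L' \<Longrightarrow> L \<inter> L' = {0} \<Longrightarrow>
               sumprod S L \<inter> sumprod S L' = {0}"
    and L: "\<And>i. i < n \<Longrightarrow> left_ideal R (Ls i)" and ind: "independent_family n Ls"
  shows "independent_family n (\<lambda>i. sumprod UNIV (Ls i))"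
  unfolding independent_family_def
proof (intro allI impI)
  fix y i assume y: "\<forall>i<n. y i \<in> sumprod UNIV (Ls i)" "(\<Sum>i<n. y i) = 0" and i: "i < n"
  let ?J = "{..<n} - {i}"
  let ?K = "ssum ?J Ls"
  have K: "left_ideal R ?K" by (rule left_ideal_ssum[OF L R_ring]) simp
  have sub: "Ls i \<subseteq> S" "?K \<subseteq> S" using L[OF i] K R_S unfolding left_ideal_def by blast+
  have disj: "sumprod S (Ls i) \<inter> sumprod S ?K = {0}"
    by (rule ii[OF L[OF i] K independent_disjoint[OF R_ring L ind i]])
  have UN: "is_subring (UNIV :: 'a set)" by (simp add: is_subring_def)
  have "y j \<in> sumprod UNIV ?K" if j: "j \<in> ?J" for j
  proof -
    have "Ls j \<subseteq> ?K"
    proof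
      fix z assume "z \<in> Ls j"
      then show "z \<in> ?K" by (rule ssum_member[rotated 2]) (use j L in \<open>auto simp: left_ideal_def\<close>)
    qed
    then have "sumprod UNIV (Ls j) \<subseteq> sumprod UNIV ?K" by (rule sumprod_mono[OF order_refl])
    then show ?thesis using y(1) j by blast
  qed
  then have "(\<Sum>j\<in>?J. y j) \<in> sumprod UNIV ?K" by (rule sumprod_sum)
  moreover have "(\<Sum>j\<in>?J. y j) = - y i"
    using y(2) unfolding sum_split_one[OF i] by (simp only: add_eq_0_iff)
  ultimately have "- 1 * (- y i) \<in> sumprod UNIV ?K" using sumprod_mult[OF UN] by (metis UNIV_I)
  then have "y i \<in> sumprod UNIV ?K" by simp
  moreover have "y i \<in> sumprod UNIV (Ls i)" using y(1) i by blast
  ultimately show "y i = 0" using sumprod_UNIV_disjoint[OF sub disj] by blast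
qed

section \<open>Descent to the nicely essential subring\<close>

lemma ness_ring: "nicely_essential C A \<Longrightarrow> is_subring C" and ness_sub: "nicely_essential C A \<Longrightarrow> C \<subseteq> A"
  unfolding nicely_essential_def by blast+

lemma meets_nicely_essential:
  assumes ne: "nicely_essential C A" and "meets f g" "f \<in> A"
  shows "\<exists>a\<in>C. \<exists>b\<in>C. a * f = b * g \<and> a * f \<noteq> 0"
proof -
  obtain a b where ab: "a \<in> A" "b \<in> A" "a * f = b * g" "a * f \<noteq> 0" using assms(2) unfolding meets_def by blast
  have "a * f \<in> A" using A_mult ab(1) assms(3) by blast
  then obtain e where e: "e \<in> C" "\<forall>y\<in>{a, b, a * f}. e * y \<in> C \<and> (y \<noteq> 0 \<longrightarrow> e * y \<noteq> 0)"
    using nicely_essential_multiple[OF ne, of "{a, b, a * f}"] ab(1,2) by auto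
  have "e * a \<in> C" "e * b \<in> C" "e * a * f = e * b * g" "e * a * f \<noteq> 0"
    using e(2) ab(3,4) by (simp_all add: mult.assoc)
  then show ?thesis by blast
qed

lemma sumprod_nicely_essential:
  assumes ne: "nicely_essential C A" and L: "L \<subseteq> A" and y: "y \<in> sumprod A L" and E: "finite E" "E \<subseteq> A"
  shows "\<exists>b\<in>C. b * y \<in> C \<inter> sumprod C L \<and> (\<forall>e\<in>E. b * e \<in> C \<and> (e \<noteq> 0 \<longrightarrow> b * e \<noteq> 0))"
  using nicely_essential_sumprod[OF ne A_ring, of "{0}" "\<lambda>_. L" "\<lambda>_. y" E] L y E by simp

text \<open>Elements of L lie in A but possibly not in C; a multiplier b in C brings a non-zero l
  into C and into C L.\<close>

lemma Int_sumprod_nonzero: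
  assumes ne: "nicely_essential C A" and L: "left_ideal R L" "L \<noteq> {0}"
  shows "C \<inter> sumprod C L \<noteq> {0}"
proof -
  have "0 \<in> L" and LR: "L \<subseteq> R" using L(1) by (auto simp: left_ideal_def)
  then obtain l where l: "l \<in> L" "l \<noteq> 0" using L(2) by blast
  have LA: "L \<subseteq> A" using LR R_A by blast
  have "1 * l \<in> sumprod A L" by (rule sumprod_prodI[OF is_subringD(1)[OF A_ring] l(1)])
  then obtain b where "b \<in> C" "b * l \<in> C \<inter> sumprod C L" "b * l \<noteq> 0"
    using sumprod_nicely_essential[OF ne LA, of l "{l}"] l LA by auto
  then show ?thesis by blast
qed

lemma uniform_Int_sumprod:
  assumes ne: "nicely_essential C A"
    and hyp: "\<forall>m\<in>DegA. \<forall>L. uniform_left_ideal R L \<longrightarrow> uniform_left_ideal (B m) (sumprod (B m) L)"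
    and L: "uniform_left_ideal R L"
  shows "uniform_left_ideal C (C \<inter> sumprod C L)"
proof (rule uniform_left_idealI)
  have LI: "left_ideal R L" "L \<noteq> {0}" using L by (auto simp: uniform_left_ideal_def)
  then have LR: "L \<subseteq> R" by (simp add: left_ideal_def)
  show "left_ideal C (C \<inter> sumprod C L)" by (rule left_ideal_Int_sumprod[OF ness_ring[OF ne]])
  show "C \<inter> sumprod C L \<noteq> {0}" by (rule Int_sumprod_nonzero[OF ne LI])
  fix f g assume fg: "f \<in> C \<inter> sumprod C L" "g \<in> C \<inter> sumprod C L" "f \<noteq> 0" "g \<noteq> 0"
  have "sumprod C L \<subseteq> sumprod A L" by (rule sumprod_mono[OF ness_sub[OF ne] order_refl])
  then have "f \<in> sumprod A L" "g \<in> sumprod A L" using fg(1,2) by blast+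
  then have "meets f g" using meets_sumprod[OF LR _ _ fg(3) _ fg(4)] hyp L by blast
  then show "\<exists>a\<in>C. \<exists>b\<in>C. a * f = b * g \<and> a * f \<noteq> 0"
    by (rule meets_nicely_essential[OF ne]) (use fg(1) ness_sub[OF ne] in blast)
qed

lemma essential_Int_sumprod:
  assumes ne: "nicely_essential C A"
    and hyp: "\<forall>m\<in>DegA. \<forall>L. essential_left_ideal R L \<longrightarrow> essential_left_ideal (B m) (sumprod (B m) L)"
    and L: "essential_left_ideal R L"
  shows "essential_left_ideal C (C \<inter> sumprod C L)"
proof (rule essential_left_idealI)
  have LR: "L \<subseteq> R" using L by (auto simp: essential_left_ideal_def left_ideal_def)
  then have LA: "L \<subseteq> A" using R_A by blast
  show "left_ideal C (C \<inter> sumprod C L)" by (rule left_ideal_Int_sumprod[OF ness_ring[OF ne]])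
  fix f assume f: "f \<in> C" "f \<noteq> 0"
  have fA: "f \<in> A" using f(1) ness_sub[OF ne] by blast
  obtain a where a: "a \<in> A" "a * f \<in> sumprod A L" "a * f \<noteq> 0"
    using essential_sumprod[OF LR _ fA f(2)] hyp L by blast
  \<comment> \<open>Only a in A is known. The multiplier b is chosen to bring a into C, to bring a *
    f into C and C L, and to keep it non-zero.\<close>
  have "{a, a * f} \<subseteq> A" using a(1) A_mult fA by blast
  then obtain b where b: "b \<in> C" "b * (a * f) \<in> C \<inter> sumprod C L"
    "\<forall>e\<in>{a, a * f}. b * e \<in> C \<and> (e \<noteq> 0 \<longrightarrow> b * e \<noteq> 0)"
    using sumprod_nicely_essential[OF ne LA a(2), of "{a, a * f}"] by auto
  have "b * a \<in> C" "b * a * f \<in> C \<inter> sumprod C L" "b * a * f \<noteq> 0"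
    using b(2,3) a(3) by (simp_all add: mult.assoc)
  then show "\<exists>a\<in>C. a * f \<in> C \<inter> sumprod C L \<and> a * f \<noteq> 0" by blast
qed

text \<open>Both f and c are top-faithful, c in degree 0, and their leading coefficients have the
  same annihilator in S; so annihilators transfer in both directions.\<close>

lemma shadow_annihilator:
  assumes "shadow f m c" shows "q * f = 0 \<longleftrightarrow> q * c = 0"
proof -
  have c: "c \<in> S" using assms R_S unfolding shadow_def by blast
  have t: "topfaithful f m" "topfaithful c 0" using assms topfaithful_const[OF c] unfolding shadow_def by blast+
  have "cf c 0 = c" using cf_const[OF c] by simp
  then have eq: "s * cf f m = 0 \<longleftrightarrow> s * cf c 0 = 0" if "s \<in> S" for s
    using assms that unfolding shadow_def by simp
  show ?thesis
    using topfaithful_annihilator[OF t eq] topfaithful_annihilator[OF t(2,1) eq[symmetric]] by blast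
qed

text \<open>A uniform U below R c contains a nice e that is the shadow of a multiple g of f. Since g
  and e have the same annihilator, A g and A e are isomorphic as left A-modules, and A e lies in A
  U, where any two non-zero elements meet. A multiplier b then brings g into the given left ideal of
  C.\<close>

lemma enough_uniform_nicely_essential:
  assumes ne: "nicely_essential C A"
    and hyp: "\<forall>m\<in>DegA. \<forall>L. uniform_left_ideal R L \<longrightarrow> uniform_left_ideal (B m) (sumprod (B m) L)"
    and enough: "enough_uniform R"
  shows "enough_uniform C"
  unfolding enough_uniform_def
proof (intro allI impI)
  fix I assume I: "left_ideal C I" "I \<noteq> {0}"
  note C = ness_ring[OF ne] and CA = subsetD[OF ness_sub[OF ne]]
  have IC: "I \<subseteq> C" "0 \<in> I" using I(1) by (auto simp: left_ideal_def)
  then obtain f where f: "f \<in> I" "f \<noteq> 0" using I(2) by blast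
  obtain M where M: "f \<in> low (Suc M)" using degree_exists[OF f(2)] .
  obtain r m c where r: "r \<in> R" "shadow (r * f) m c" using shadow_exists[OF f(2) M] by blast
  have cR: "c \<in> R" and c0: "c \<noteq> 0" using r(2) shadow_nonzero[OF r(2)] unfolding shadow_def by blast+
  have "1 * c \<in> {a * c |a. a \<in> R}" using is_subringD(1)[OF R_ring] by blast
  then have "{a * c |a. a \<in> R} \<noteq> {0}" using c0 by auto
  then obtain U where U: "U \<subseteq> {a * c |a. a \<in> R}" "uniform_left_ideal R U"
    using enough left_ideal_principal[OF R_ring cR] unfolding enough_uniform_def by blast
  have UI: "left_ideal R U" "U \<noteq> {0}" using U(2) unfolding uniform_left_ideal_def by blast+
  have "0 \<in> U" and UR: "U \<subseteq> R" using UI(1) unfolding left_ideal_def by blast+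
  then obtain z where "z \<in> U" "z \<noteq> 0" using UI(2) by blast
  then obtain r1 where r1: "r1 \<in> R" "r1 * c \<in> U" "r1 * c \<noteq> 0" using U(1) by blast
  obtain r2 where r2: "r2 \<in> R" "Rnice (r2 * (r1 * c))" using nice_multiple[OF r1(3)] by blast
  define r3 where "r3 = r2 * r1"
  define e where "e = r3 * c"
  define g where "g = r3 * (r * f)"
  have r3: "r3 \<in> R" unfolding r3_def using R_mult r1(1) r2(1) by blast
  have sh: "shadow g m e" unfolding g_def e_def
    by (rule shadow_smult[OF r(2) r3]) (use r2(2) in \<open>simp add: r3_def mult.assoc\<close>)
  have "r2 * (r1 * c) \<in> U" using UI(1) r2(1) r1(2) unfolding left_ideal_def by blast
  then have eU: "e \<in> U" by (simp add: e_def r3_def mult.assoc)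
  have fA: "f \<in> A" using f(1) IC(1) CA by blast
  have rA: "r3 * r \<in> A" using R_A R_mult r3 r(1) by blast
  have gA: "g \<in> A" unfolding g_def mult.assoc[symmetric] using A_mult rA fA by blast
  \<comment> \<open>As r3 * r may lie outside C, g may lie outside I. With b * (r3 * r) in C the
    element b * g does belong to I.\<close>
  obtain b where b: "b \<in> C" "b * (r3 * r) \<in> C" "b * g \<noteq> 0"
    using nicely_essential_multiple[OF ne, of "{r3 * r, g}"] rA gA shadow_nonzero[OF sh] by auto
  have "b * g = b * (r3 * r) * f" by (simp add: g_def mult.assoc)
  then have bgI: "b * g \<in> I" using I(1) f(1) b(2) unfolding left_ideal_def by auto
  let ?V = "{a * (b * g) |a. a \<in> C}"
  have bgC: "b * g \<in> C" using bgI IC(1) by blast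
  have "uniform_left_ideal C ?V"
  proof (rule uniform_left_idealI)
    show "left_ideal C ?V" by (rule left_ideal_principal[OF C bgC])
    have "1 * (b * g) \<in> ?V" using is_subringD(1)[OF C] by blast
    then show "?V \<noteq> {0}" using b(3) by auto
    fix y1 y2 assume y: "y1 \<in> ?V" "y2 \<in> ?V" "y1 \<noteq> 0" "y2 \<noteq> 0"
    then obtain a1 a2 where a: "a1 \<in> C" "a2 \<in> C" "y1 = a1 * (b * g)" "y2 = a2 * (b * g)" by blast
    define p1 where "p1 = a1 * b"
    define p2 where "p2 = a2 * b"
    have p: "p1 \<in> A" "p2 \<in> A" unfolding p1_def p2_def using A_mult CA a(1,2) b(1) by blast+
    have yp: "y1 = p1 * g" "y2 = p2 * g" using a(3,4) by (simp_all add: p1_def p2_def mult.assoc)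
    have nz: "p1 * e \<noteq> 0" "p2 * e \<noteq> 0"
      using y(3,4) unfolding yp shadow_annihilator[OF sh] by blast+
    have in': "p1 * e \<in> sumprod A U" "p2 * e \<in> sumprod A U" using sumprod_prodI p eU by blast+
    have "meets (p1 * e) (p2 * e)"
      using meets_sumprod[OF UR _ in'(1) nz(1) in'(2) nz(2)] hyp U(2) by blast
    then obtain q1 q2 where q: "q1 \<in> A" "q2 \<in> A" "q1 * (p1 * e) = q2 * (p2 * e)" "q1 * (p1 * e) \<noteq> 0"
      unfolding meets_def by blast
    \<comment> \<open>The relation found for e is an annihilator condition, so it carries over to
      g.\<close>
    have "(q1 * p1 - q2 * p2) * e = 0" using q(3) by (simp add: left_diff_distrib mult.assoc)
    then have "(q1 * p1 - q2 * p2) * g = 0" unfolding shadow_annihilator[OF sh] .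
    then have "q1 * y1 = q2 * y2" by (simp add: yp left_diff_distrib mult.assoc)
    moreover have "q1 * p1 * g \<noteq> 0" unfolding shadow_annihilator[OF sh] using q(4) by (simp add: mult.assoc)
    then have "q1 * y1 \<noteq> 0" by (simp add: yp mult.assoc)
    ultimately have "meets y1 y2" unfolding meets_def using q(1,2) by blast
    then show "\<exists>a\<in>C. \<exists>b\<in>C. a * y1 = b * y2 \<and> a * y1 \<noteq> 0"
      by (rule meets_nicely_essential[OF ne]) (use yp(1) p(1) gA A_mult in blast)
  qed
  moreover have "?V \<subseteq> I" using I(1) bgI unfolding left_ideal_def by blast
  ultimately show "\<exists>U\<subseteq>I. uniform_left_ideal C U" by blast
qed

text \<open>Independence of extended left ideals gives the lower bound. For the upper bound, an
  essential sum of k uniform left ideals of R is carried over to C and compared with an arbitrary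
  independent family by exchange.\<close>

lemma udim_nicely_essential:
  assumes ne: "nicely_essential C A"
    and ii: "\<And>L L'. left_ideal R L \<Longrightarrow> left_ideal R L' \<Longrightarrow> L \<inter> L' = {0} \<Longrightarrow>
               sumprod S L \<inter> sumprod S L' = {0}"
    and hypu: "\<forall>m\<in>DegA. \<forall>L. uniform_left_ideal R L \<longrightarrow> uniform_left_ideal (B m) (sumprod (B m) L)"
    and hype: "\<forall>m\<in>DegA. \<forall>L. essential_left_ideal R L \<longrightarrow> essential_left_ideal (B m) (sumprod (B m) L)"
    and enough: "enough_uniform R"
  shows "udim C = udim R"
proof (rule antisym)
  note C = ness_ring[OF ne]
  have ind: "independent_family n (\<lambda>i. C \<inter> sumprod C (Ls i))"
    if L: "\<And>i. i < n \<Longrightarrow> left_ideal R (Ls i)" "independent_family n Ls" for n Ls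
  proof (rule independent_subfamily)
    show "independent_family n (\<lambda>i. sumprod UNIV (Ls i))" by (rule independent_sumprod[OF ii L])
    show "C \<inter> sumprod C (Ls i) \<subseteq> sumprod UNIV (Ls i)" for i
      using sumprod_mono[of C UNIV "Ls i" "Ls i"] by blast
  qed
  show "udim R \<le> udim C"
    unfolding udim_alt[of R]
  proof (rule Sup_least, elim CollectE exE conjE)
    fix z n Ls assume z: "z = enat n" and L: "\<forall>i<n. left_ideal R (Ls i) \<and> Ls i \<noteq> {0}" "independent_family n Ls"
    have "enat n \<le> udim C"
    proof (rule udim_ge)
      show "left_ideal C (C \<inter> sumprod C (Ls i)) \<and> C \<inter> sumprod C (Ls i) \<noteq> {0}" if "i < n" for i
        using left_ideal_Int_sumprod[OF C] Int_sumprod_nonzero[OF ne] L(1) that by simp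
      show "independent_family n (\<lambda>i. C \<inter> sumprod C (Ls i))" by (rule ind) (use L in simp_all)
    qed
    then show "z \<le> udim C" by (simp add: z)
  qed
  show "udim C \<le> udim R"
  proof (cases "udim R")
    case (enat k)
    obtain U where "\<forall>i<k. uniform_left_ideal R (U i)" and indU: "independent_family k U"
      and ess: "essential_left_ideal R (ssum {..<k} U)"
      using essential_uniform_sum[OF R_ring enough enat] by blast
    then have U: "uniform_left_ideal R (U i)" if "i < k" for i using that by blast
    have UI: "left_ideal R (U i)" if "i < k" for i using U[OF that] unfolding uniform_left_ideal_def by blast
    have UA: "U i \<subseteq> A" if "i < k" for i using UI[OF that] R_A unfolding left_ideal_def by blast
    define V where "V i = C \<inter> sumprod C (U i)" for i
    have V: "uniform_left_ideal C (V i)" if "i < k" for i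
      unfolding V_def by (rule uniform_Int_sumprod[OF ne hypu U[OF that]])
    have indV: "independent_family k V" unfolding V_def by (rule ind[OF UI indU])
    \<comment> \<open>An element of C (U 0 + ... + U (k - 1)) splits into parts in the A U i, which
      need not belong to C; a further multiplier handles this below.\<close>
    have sub: "sumprod C (ssum {..<k} U) \<subseteq> ssum {..<k} (\<lambda>i. sumprod A (U i))"
    proof (rule sumprod_subset[OF _ _ ness_sub[OF ne]])
      show "left_ideal A (ssum {..<k} (\<lambda>i. sumprod A (U i)))"
        by (rule left_ideal_ssum[OF left_ideal_sumprod[OF A_ring UA] A_ring]) simp
      show "ssum {..<k} U \<subseteq> ssum {..<k} (\<lambda>i. sumprod A (U i))"
      proof
        fix y assume "y \<in> ssum {..<k} U"
        then obtain z where z: "y = (\<Sum>j<k. z j)" "\<forall>j\<in>{..<k}. z j \<in> U j" unfolding ssum_def by blast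
        have "z j \<in> sumprod A (U j)" if "j \<in> {..<k}" for j
          using sumprod_prodI[OF is_subringD(1)[OF A_ring], of "z j" "U j"] z(2) that by simp
        then show "y \<in> ssum {..<k} (\<lambda>i. sumprod A (U i))" unfolding z(1) by (rule ssumI)
      qed
    qed
    have essV: "\<exists>a\<in>C. a * f \<in> ssum {..<k} V \<and> a * f \<noteq> 0" if f: "f \<in> C" "f \<noteq> 0" for f
    proof -
      obtain a where a: "a \<in> C" "a * f \<in> C \<inter> sumprod C (ssum {..<k} U)" "a * f \<noteq> 0"
        using essential_multiple[OF C essential_Int_sumprod[OF ne hype ess] f] by blast
      have "a * f \<in> ssum {..<k} (\<lambda>i. sumprod A (U i))" using a(2) sub by blast
      then obtain y where y: "a * f = (\<Sum>j<k. y j)" "\<forall>j\<in>{..<k}. y j \<in> sumprod A (U j)"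
        unfolding ssum_def by blast
      \<comment> \<open>One b moves all parts y j into the V j simultaneously and keeps their sum
        non-zero.\<close>
      have "\<exists>b\<in>C. (\<forall>j\<in>{..<k}. b * y j \<in> C \<inter> sumprod C (U j)) \<and>
          (\<forall>e\<in>{a * f}. b * e \<in> C \<and> (e \<noteq> 0 \<longrightarrow> b * e \<noteq> 0))"
        by (rule nicely_essential_sumprod[OF ne A_ring])
          (use UA y(2) a(2) ness_sub[OF ne] in auto)
      then obtain b where b: "b \<in> C" "\<forall>j\<in>{..<k}. b * y j \<in> V j" "b * (a * f) \<noteq> 0"
        using a(3) unfolding V_def by blast
      have "(\<Sum>j<k. b * y j) \<in> ssum {..<k} V" by (rule ssumI) (use b(2) in blast)
      then have "b * a * f \<in> ssum {..<k} V" using y(1) by (simp add: mult.assoc sum_distrib_left)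
      moreover have "b * a * f \<noteq> 0" using b(3) by (simp add: mult.assoc)
      moreover have "b * a \<in> C" using is_subringD(4)[OF C b(1) a(1)] .
      ultimately show ?thesis by blast
    qed
    show ?thesis unfolding udim_alt[of C] enat
    proof (rule Sup_least, elim CollectE exE conjE)
      fix z n I assume z: "z = enat n" and I: "\<forall>i<n. left_ideal C (I i) \<and> I i \<noteq> {0}" "independent_family n I"
      have "n \<le> k"
        by (rule independent_family_bound[OF C V indV essV _ I(2)]) (use I(1) in simp_all)
      then show "z \<le> enat k" by (simp add: z)
    qed
  \<comment> \<open>The remaining case is infinite \<open>udim R\<close>, where the bound is
    trivial.\<close>
  qed simp
qed

end

theorem mainTheorem13:
  fixes R S T :: "'a::ring_1 set" and \<alpha> \<delta> :: "'a \<Rightarrow> 'a" and x :: 'a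
    and A At :: "'a set" and ups :: "nat \<Rightarrow> 'a" and B :: "nat \<Rightarrow> 'a set" and am :: "nat \<Rightarrow> 'a \<Rightarrow> 'a"
  assumes U: "setting_U R S T \<alpha> \<delta> x"
    and i: "\<And>p. p \<in> S \<Longrightarrow> R_nice R S T x p \<Longrightarrow> lann S p = sumprod S (lann R p)"
    and ii: "\<And>L L'. left_ideal R L \<Longrightarrow> left_ideal R L' \<Longrightarrow> L \<inter> L' = {0} \<Longrightarrow>
               sumprod S L \<inter> sumprod S L' = {0}"
    and spec: "special_subext R S x At ups B am"
    and ness: "nicely_essential A At"
    and nice: "\<And>a. a \<in> R \<Longrightarrow> a \<noteq> 0 \<Longrightarrow>
               \<exists>f \<in> {g * a | g. g \<in> At}. R_nice R S T x f \<and> odeg S x f = dA S x At"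
  shows "((\<forall>m\<in>Deg S x At. \<forall>L. uniform_left_ideal R L \<longrightarrow> uniform_left_ideal (B m) (sumprod (B m) L))
            \<longrightarrow> (\<forall>L. uniform_left_ideal R L \<longrightarrow> uniform_left_ideal A (A \<inter> sumprod A L)))
       \<and> ((\<forall>m\<in>Deg S x At. \<forall>L. essential_left_ideal R L \<longrightarrow> essential_left_ideal (B m) (sumprod (B m) L))
            \<longrightarrow> (\<forall>L. essential_left_ideal R L \<longrightarrow> essential_left_ideal A (A \<inter> sumprod A L)))
       \<and> ((\<forall>m\<in>Deg S x At. \<forall>L. uniform_left_ideal R L \<longrightarrow> uniform_left_ideal (B m) (sumprod (B m) L))
           \<and> (\<forall>m\<in>Deg S x At. \<forall>L. essential_left_ideal R L \<longrightarrow> essential_left_ideal (B m) (sumprod (B m) L))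
           \<and> enough_uniform R
            \<longrightarrow> enough_uniform A \<and> udim A = udim R)"
proof -
  have ore: "ore_extension S \<alpha> \<delta> x" using U by (simp add: setting_U_def)
  \<comment> \<open>The locale is entered with \<open>At\<close> as its special subextension; the
    ring \<open>A\<close> of the theorem then takes the place of \<open>C\<close>.\<close>
  interpret special_ext S \<alpha> \<delta> x R T At ups B am
    by (intro special_ext.intro ore.intro special_ext_axioms.intro ore U i spec nice)
  show ?thesis
    using uniform_Int_sumprod[OF ness] essential_Int_sumprod[OF ness]
      enough_uniform_nicely_essential[OF ness] udim_nicely_essential[OF ness ii]
    by blast
qed

end
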